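(* Let $W$ be a Wiener process, let $L_t^0(W)$ be its local time at zero, and define the running maximum by $S_t=\sup_{s\le t}W_s$. Then, for every $t\ge 0$, $$L_t^0(W)\stackrel{d}{=}S_t ,$$ where $\stackrel{d}{=}$ denotes equality in distribution.
   Context: $W$ is a standard one-dimensional Wiener process with $W_0=0$. Its local time $L_t^x=L_t^x(W)$ is the density with respect to Lebesgue measure of the occupation measure $T_t(A)=\int_0^t I_A(W_s)\,ds$ ($A\subseteq\mathbb{R}$ Borel), taken in its version that is almost surely jointly continuous in $(t,x)$; equivalently $L_t^x=\lim_{\epsilon\downarrow0}\frac{1}{2\epsilon}\int_0^t I\{x-\epsilon\le W_s\le x+\epsilon\}\,ds$. *)

theory Defs
  imports "HOL-Probability.Probability"
begin

text \<open>
  Time is the half-line \<open>{0..}\<close>; values of processes at negative times are irrelevant.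
  Paths are only required to be continuous almost surely.
\<close>

locale wiener_process = prob_space M for M :: "'a measure" +
  fixes W :: "real \<Rightarrow> 'a \<Rightarrow> real"
  assumes random_variable_W: "\<And>t. 0 \<le> t \<Longrightarrow> random_variable borel (W t)"
    and W_0: "AE \<omega> in M. W 0 \<omega> = 0"
    and indep_increments:
      "\<And>(n::nat) (\<tau>::nat \<Rightarrow> real). \<lbrakk>0 \<le> \<tau> 0; \<And>i. i < n \<Longrightarrow> \<tau> i < \<tau> (Suc i)\<rbrakk> \<Longrightarrow>
        indep_vars (\<lambda>_. borel) (\<lambda>i \<omega>. W (\<tau> (Suc i)) \<omega> - W (\<tau> i) \<omega>) {..<n}"
    and normal_increments:
      "\<And>s t. \<lbrakk>0 \<le> s; s < t\<rbrakk> \<Longrightarrow>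
        distributed M lborel (\<lambda>\<omega>. W t \<omega> - W s \<omega>) (normal_density 0 (sqrt (t - s)))"
    and continuous_paths: "AE \<omega> in M. continuous_on {0..} (\<lambda>t. W t \<omega>)"

definition occupation_measure ::
    "(real \<Rightarrow> 'a \<Rightarrow> real) \<Rightarrow> real \<Rightarrow> 'a \<Rightarrow> real set \<Rightarrow> ennreal" where
  "occupation_measure X t \<omega> A = (\<integral>\<^sup>+ s \<in> {0..t}. indicator A (X s \<omega>) \<partial>lborel)"

text \<open>
  \<open>is_local_time M X L\<close>: the random field \<open>L t x \<omega>\<close> is the (almost surely jointly continuous
  version of the) local time of \<open>X\<close>. The condition \<open>0 \<le> L t x \<omega>\<close> is needed because \<open>ennreal\<close>
  truncates negative values, so that the density equation alone would not see them.
\<close>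

definition is_local_time ::
    "'a measure \<Rightarrow> (real \<Rightarrow> 'a \<Rightarrow> real) \<Rightarrow> (real \<Rightarrow> real \<Rightarrow> 'a \<Rightarrow> real) \<Rightarrow> bool" where
  "is_local_time M X L \<longleftrightarrow>
    (AE \<omega> in M. continuous_on ({0..} \<times> UNIV) (\<lambda>(t, x). L t x \<omega>)) \<and>
    (AE \<omega> in M. \<forall>t\<ge>0. (\<forall>x. 0 \<le> L t x \<omega>) \<and>
      (\<forall>A \<in> sets borel.
        occupation_measure X t \<omega> A = (\<integral>\<^sup>+ x \<in> A. ennreal (L t x \<omega>) \<partial>lborel)))"

definition running_max :: "(real \<Rightarrow> 'a \<Rightarrow> real) \<Rightarrow> real \<Rightarrow> 'a \<Rightarrow> real" where
  "running_max X t \<omega> = (SUP s \<in> {0..t}. X s \<omega>)"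

text \<open>
  Local time and running maximum are determined by the continuous paths only up to a null set,
  so they are random variables on the completion of the probability space, and their laws are
  taken there. For \<open>M\<close>-measurable random variables this is the usual law on \<open>M\<close>.
\<close>

definition eq_in_distribution :: "'a measure \<Rightarrow> ('a \<Rightarrow> real) \<Rightarrow> ('a \<Rightarrow> real) \<Rightarrow> bool" where
  "eq_in_distribution M X Y \<longleftrightarrow>
    X \<in> borel_measurable (completion M) \<and> Y \<in> borel_measurable (completion M) \<and>
    distr (completion M) borel X = distr (completion M) borel Y"

end

theory Submission
  imports Defs
begin

text \<open>
  The argument is a discrete form of Tanaka's formula. Sample the path at spacing \<open>t / n\<close>, giving a
  Gaussian walk \<open>X\<close>, and put \<open>\<beta>\<^sub>k = (\<Sum>i<k. sgn (X\<^sub>i) (X\<^sub>i\<^sub>+\<^sub>1 - X\<^sub>i))\<close>. The process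
  \<open>\<bar>X\<bar> - \<beta>\<close> is nondecreasing and grows only at sign changes of \<open>X\<close>, so, up to the largest step, it
  equals the running maximum of \<open>- \<beta>\<close>. Since each sign is independent of the step it multiplies and
  the steps are symmetric, \<open>- \<beta>\<close> has exactly the law of \<open>X\<close>; hence that maximum has the law of the
  discrete running maximum of \<open>X\<close>. On the other hand, a Taylor expansion of a mollified \<open>\<bar>x\<bar>\<close>
  shows that \<open>\<bar>X\<^sub>n\<bar> - \<beta>\<^sub>n\<close> is \<open>L\<^sup>1\<close>-close to half the Riemann sum of \<open>f''(W)\<close>, which converges
  to the local time at zero when first \<open>n \<rightarrow> \<infinity>\<close> and then the mollification vanishes. The laws are
  compared through characteristic functions.
\<close>

subsection \<open>A mollified absolute value\<close>

text \<open>In the continuum the decomposition is |W| = \<beta> + L with \<beta> = \<integral>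
  sgn(W) dW, and recognising \<beta> as a Wiener process takes Levy's characterisation. For a
  symmetric walk the matching identity of laws is exact at every grid size, so no stochastic
  integral enters. The price is that the discrete local time records only sign changes, and it is
  compared with the occupation density in mean, through a smooth function. The order of the limits
  is dictated by the estimate: the Taylor remainder is of total order sqrt \<delta> / e^2, so the
  grid has to be refined at fixed e. What survives is 2 e + sqrt (8 e sqrt t), which vanishes with
  e. The steps of the comparison are of different kinds: equality in law, almost sure closeness,
  closeness in mean. All three are seen by characteristic functions.\<close>

text \<open>
  The second difference of \<open>\<bar>x\<bar>\<^sup>3 / 6\<close> is \<open>\<bar>x\<bar>\<close> convolved with a triangular kernel supported in
  \<open>[-e, e]\<close>. Its derivatives are written out explicitly, so that the Taylor bound below is an
  algebraic inequality.
\<close>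

definition smooth_abs :: "real \<Rightarrow> real \<Rightarrow> real" where
  "smooth_abs e x = (\<bar>x + e\<bar>^3 + \<bar>x - e\<bar>^3 - 2 * \<bar>x\<bar>^3) / (6 * e\<^sup>2)"

definition smooth_abs' :: "real \<Rightarrow> real \<Rightarrow> real" where
  "smooth_abs' e x = ((x + e) * \<bar>x + e\<bar> + (x - e) * \<bar>x - e\<bar> - 2 * (x * \<bar>x\<bar>)) / (2 * e\<^sup>2)"

definition smooth_abs'' :: "real \<Rightarrow> real \<Rightarrow> real" where
  "smooth_abs'' e x = (\<bar>x + e\<bar> + \<bar>x - e\<bar> - 2 * \<bar>x\<bar>) / e\<^sup>2"

text \<open>The second derivative 6 |x| of |x|^3 is Lipschitz with constant 6. By the symmetry under
  changing the signs of both x and h, take x \<ge> 0: without a sign change the remainder is exactly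
  h^3, otherwise it is 2 a^3 - |h|^3 with a = |x + h| \<le> |h|.\<close>

lemma abs_cube_taylor:
  fixes x h :: real
  shows "\<bar>\<bar>x + h\<bar>^3 - \<bar>x\<bar>^3 - 3 * (x * \<bar>x\<bar>) * h - 3 * \<bar>x\<bar> * h\<^sup>2\<bar> \<le> \<bar>h\<bar>^3"
proof -
  have *: "\<bar>(y + h)^3 * s - y^3 - 3 * y\<^sup>2 * h - 3 * y * h\<^sup>2\<bar> \<le> \<bar>h\<bar>^3"
    if "y \<ge> 0" "s = sgn (y + h)" for y h s :: real
  proof (cases "y + h \<ge> 0")
    case True
    have "(y + h)^3 * s - y^3 - 3 * y\<^sup>2 * h - 3 * y * h\<^sup>2 = h^3"
      using that True by (cases "y + h = 0")
        (auto simp: power2_eq_square power3_eq_cube algebra_simps eq_neg_iff_add_eq_0[symmetric])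
    then show ?thesis by (simp add: power_abs)
  next
    case False
    define a where "a = - (y + h)"
    have a: "0 \<le> a" "a \<le> - h" using False that by (auto simp: a_def)
    have "(y + h)^3 * s - y^3 - 3 * y\<^sup>2 * h - 3 * y * h\<^sup>2 = 2 * a^3 - (- h)^3"
      using that False by (auto simp: a_def power2_eq_square power3_eq_cube algebra_simps)
    moreover have "0 \<le> a^3" "a^3 \<le> (- h)^3" using a by (auto intro!: power_mono simp del: power_minus_odd)
    moreover have "\<bar>h\<bar> = - h" using a by linarith
    ultimately show ?thesis by (simp only: power_abs abs_le_iff) (simp del: zero_le_power_eq)
  qed
  have ab: "\<bar>z\<bar>^3 = z^3 * sgn z" for z :: real
    by (cases "z \<ge> 0") (auto simp: sgn_real_def)
  show ?thesis
  proof (cases "x \<ge> 0")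
    case True
    with *[OF True refl, of h] show ?thesis
      by (simp add: ab[of "x + h"] power2_eq_square mult.assoc)
  next
    case False
    then have "\<bar>x + h\<bar>^3 = (- x + - h)^3 * sgn (- x + - h)"
      using ab[of "- x + - h"] abs_minus_cancel[of "x + h"] by (simp only: minus_add_distrib)
    with *[of "- x" _ "- h", OF _ refl] False show ?thesis
      by (simp add: power2_eq_square mult.assoc)
  qed
qed

text \<open>The remainder is a combination of three cubic remainders with weights 1, 1, -2, hence at
  most 4 |h|^3 before the division by 6 e^2.\<close>

lemma smooth_abs_taylor:
  assumes "e > 0"
  shows "\<bar>smooth_abs e (x + h) - smooth_abs e x - smooth_abs' e x * h - smooth_abs'' e x * h\<^sup>2 / 2\<bar>
    \<le> \<bar>h\<bar>^3 / e\<^sup>2"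
proof -
  define r where "r x = \<bar>x + h\<bar>^3 - \<bar>x\<bar>^3 - 3 * (x * \<bar>x\<bar>) * h - 3 * \<bar>x\<bar> * h\<^sup>2" for x
  have r: "\<bar>r x\<bar> \<le> \<bar>h\<bar>^3" for x unfolding r_def by (rule abs_cube_taylor)
  have "smooth_abs e (x + h) - smooth_abs e x - smooth_abs' e x * h - smooth_abs'' e x * h\<^sup>2 / 2
    = (r (x + e) + r (x - e) - 2 * r x) / (6 * e\<^sup>2)"
  proof -
    have "a / (6 * k) - b / (6 * k) - c / (2 * k) * h - d / k * h\<^sup>2 / 2 = (a - b - 3 * c * h - 3 * d * h\<^sup>2) / (6 * k)"
      if "k \<noteq> 0" for a b c d k :: real
      using that by (simp add: field_simps)
    from this[of "e\<^sup>2"] show ?thesis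
      using assms unfolding smooth_abs_def smooth_abs'_def smooth_abs''_def r_def
      by (simp add: add_ac) (simp add: algebra_simps)
  qed
  moreover have "\<bar>r (x + e) + r (x - e) - 2 * r x\<bar> \<le> 4 * \<bar>h\<bar>^3"
    using r[of "x + e"] r[of "x - e"] r[of x] by linarith
  ultimately show ?thesis using assms
    by (simp only: abs_divide) (simp add: field_simps)
qed

lemma smooth_abs_minus: "smooth_abs e (- x) = smooth_abs e x"
  using abs_minus_commute[of "- x" e] abs_minus_commute[of e x]
  by (simp add: smooth_abs_def add.commute)

lemma smooth_abs'_minus: "smooth_abs' e (- x) = - smooth_abs' e x"
proof -
  have "\<bar>- x + e\<bar> = \<bar>x - e\<bar>" "\<bar>- x - e\<bar> = \<bar>x + e\<bar>" by auto
  then show ?thesis by (simp add: smooth_abs'_def divide_simps) (simp add: algebra_simps)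
qed

lemma smooth_abs_eq_abs:
  assumes "0 < e" "e \<le> \<bar>x\<bar>"
  shows "smooth_abs e x = \<bar>x\<bar>"
proof -
  have "smooth_abs e y = y" if "e \<le> y" for y
    using assms that by (auto simp: smooth_abs_def field_simps power2_eq_square power3_eq_cube)
  then show ?thesis using assms smooth_abs_minus[of e x] by (cases "x \<ge> 0") auto
qed

lemma smooth_abs_near_abs:
  assumes "0 < e"
  shows "\<bar>smooth_abs e x - \<bar>x\<bar>\<bar> \<le> e"
proof (cases "e \<le> \<bar>x\<bar>")
  case True
  then show ?thesis using smooth_abs_eq_abs assms by simp
next
  case False
  define a where "a = \<bar>x\<bar>"
  have a: "0 \<le> a" "a < e" using False by (auto simp: a_def)
  \<comment> \<open>Inside (-e, e) the mollification lies above |x| by this explicit cubic, whose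
    largest value is e / 3 at the origin.\<close>
  have "smooth_abs e x - \<bar>x\<bar> = (e - a)^3 / (3 * e\<^sup>2)"
    using assms False unfolding a_def
    by (cases "x \<ge> 0") (auto simp: smooth_abs_def abs_if field_simps power2_eq_square power3_eq_cube)
  moreover have "(e - a)^3 \<le> e^3" "0 \<le> (e - a)^3" using a by (auto intro: power_mono)
  then have "0 \<le> (e - a)^3 / (3 * e\<^sup>2)" "(e - a)^3 \<le> e^3" by simp_all
  moreover have "e^3 \<le> e * (3 * e\<^sup>2)"
    using assms by (simp add: power2_eq_square power3_eq_cube)
  ultimately show ?thesis using assms
    by (simp only: abs_of_nonneg) (simp add: pos_divide_le_eq)
qed

text \<open>The left derivative of |x|. The value -1 at 0 matters: multiplication by a sign that is
  never 0 preserves the law of a symmetric step, and the walk starts at 0.\<close>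

definition left_sgn :: "real \<Rightarrow> real" where
  "left_sgn x = (if x \<le> 0 then - 1 else 1)"

text \<open>The mollified derivative equals the sign for |x| \<ge> e and is bounded by 1 inside. The
  indicator confines the error to visits near 0, whose expected duration is bounded later.\<close>

lemma smooth_abs'_near_sgn:
  assumes "0 < e"
  shows "\<bar>smooth_abs' e x - left_sgn x\<bar> \<le> 2 * indicator {-e..e} x"
proof (cases "e \<le> \<bar>x\<bar>")
  case True
  have "smooth_abs' e y = 1" if "e \<le> y" for y
    using assms that by (auto simp: smooth_abs'_def field_simps power2_eq_square)
  then have "smooth_abs' e x = left_sgn x"
    using assms True smooth_abs'_minus[of e x] by (cases "x \<ge> 0") (auto simp: left_sgn_def)
  then show ?thesis by simp
next
  case False
  define a where "a = \<bar>x\<bar>"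
  have a: "0 \<le> a" "a < e" using False by (auto simp: a_def)
  have "smooth_abs' e x = sgn x * (1 - (e - a)\<^sup>2 / e\<^sup>2)"
    using assms False unfolding a_def
    by (cases "x \<ge> 0") (auto simp: smooth_abs'_def abs_if field_simps power2_eq_square sgn_real_def)
  moreover have "0 \<le> (e - a)\<^sup>2 / e\<^sup>2" "(e - a)\<^sup>2 / e\<^sup>2 \<le> 1"
    using a by (auto simp: power_mono)
  ultimately have "\<bar>smooth_abs' e x\<bar> \<le> 1"
    by (auto simp: sgn_real_def)
  with False show ?thesis
    by (auto simp: left_sgn_def indicator_def abs_if split: if_splits)
qed

text \<open>A triangle of height 2 / e over [-e, e], approximating twice a point mass at 0.\<close>

lemma smooth_abs''_eq:
  assumes "0 < e"
  shows "smooth_abs'' e x = 2 * max 0 (e - \<bar>x\<bar>) / e\<^sup>2"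
  using assms by (auto simp: smooth_abs''_def max_def abs_if)

lemma smooth_abs''_bounds:
  assumes "0 < e"
  shows "0 \<le> smooth_abs'' e x" "smooth_abs'' e x \<le> 2 / e"
  using assms by (auto simp: smooth_abs''_eq max_def field_simps power2_eq_square)

text \<open>At e = 0 division by zero makes the function constantly 0. Having continuity for every
  real e lets a later almost sure statement quantify over all e inside one null set.\<close>

lemma continuous_smooth_abs'': "continuous_on A (smooth_abs'' e)"
proof (cases "e = 0")
  case True
  then have "smooth_abs'' e = (\<lambda>x. 0)" by (auto simp: smooth_abs''_def)
  then show ?thesis by simp
qed (auto simp: smooth_abs''_def[abs_def] intro!: continuous_intros)

lemma borel_measurable_smooth_abs [measurable]:
  "smooth_abs e \<in> borel_measurable borel" "smooth_abs' e \<in> borel_measurable borel"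
  "smooth_abs'' e \<in> borel_measurable borel" "left_sgn \<in> borel_measurable borel"
  unfolding smooth_abs_def[abs_def] smooth_abs'_def[abs_def] smooth_abs''_def[abs_def]
    left_sgn_def[abs_def] by measurable

text \<open>The first derivative climbs from -1 at -e to 1 at e. The mass 2 cancels against the 1/2
  of the second-order Taylor term, so that the limit is the local time itself.\<close>

lemma nn_integral_smooth_abs'':
  assumes "0 < e"
  shows "(\<integral>\<^sup>+ x. ennreal (smooth_abs'' e x) \<partial>lborel) = 2"
proof -
  define F where "F = (\<lambda>x. smooth_abs' e x)"
  have d: "((\<lambda>x. x * \<bar>x\<bar>) has_real_derivative 2 * \<bar>x\<bar>) (at x)" for x :: real
  proof (cases "x = 0")
    case True
    have "((\<lambda>h::real. h * \<bar>h\<bar> / h) \<longlongrightarrow> 0) (at 0)"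
    proof (rule Lim_transform_eventually)
      show "((\<lambda>h::real. \<bar>h\<bar>) \<longlongrightarrow> 0) (at 0)" by real_asymp
      show "\<forall>\<^sub>F h in at (0::real). \<bar>h\<bar> = h * \<bar>h\<bar> / h"
        by (auto simp: eventually_at_filter)
    qed
    then show ?thesis using True by (simp add: DERIV_def)
  next
    case False
    \<comment> \<open>Away from 0 the sign is locally constant, so the function is a parabola near
      x.\<close>
    have "((\<lambda>y. sgn x * y\<^sup>2) has_real_derivative 2 * \<bar>x\<bar>) (at x)"
      by (auto intro!: derivative_eq_intros simp: sgn_real_def)
    then show ?thesis
    proof (rule has_field_derivative_transform_within_open)
      show "open {y. sgn x * y > 0}"
        by (intro open_Collect_less continuous_intros)
      show "x \<in> {y. sgn x * y > 0}" using False by (simp add: sgn_real_def)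
      show "sgn x * y\<^sup>2 = y * \<bar>y\<bar>" if "y \<in> {y. sgn x * y > 0}" for y
        using that by (auto simp: sgn_real_def power2_eq_square split: if_splits)
    qed
  qed
  have F: "(F has_real_derivative smooth_abs'' e x) (at x)" for x
  proof -
    have 1: "((\<lambda>x. (x + e) * \<bar>x + e\<bar>) has_real_derivative 2 * \<bar>x + e\<bar>) (at x)"
      using DERIV_shift[of "\<lambda>x. x * \<bar>x\<bar>" "2 * \<bar>x + e\<bar>" x e] d by auto
    have 2: "((\<lambda>x. (x - e) * \<bar>x - e\<bar>) has_real_derivative 2 * \<bar>x - e\<bar>) (at x)"
      using DERIV_shift[of "\<lambda>x. x * \<bar>x\<bar>" "2 * \<bar>x - e\<bar>" x "-e"] d by auto
    have "(F has_real_derivative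
      (2 * \<bar>x + e\<bar> + 2 * \<bar>x - e\<bar> - 2 * (2 * \<bar>x\<bar>)) / (2 * e\<^sup>2)) (at x)"
      unfolding F_def smooth_abs'_def
      by (intro DERIV_cdivide DERIV_diff DERIV_add DERIV_cmult 1 2 d)
    moreover have "(2 * \<bar>x + e\<bar> + 2 * \<bar>x - e\<bar> - 2 * (2 * \<bar>x\<bar>)) / (2 * e\<^sup>2) = smooth_abs'' e x"
      using assms by (simp add: smooth_abs''_def field_simps)
    ultimately show ?thesis by simp
  qed
  have "(\<integral>\<^sup>+ x. ennreal (smooth_abs'' e x) \<partial>lborel)
    = (\<integral>\<^sup>+ x. ennreal (smooth_abs'' e x) * indicator {-e..e} x \<partial>lborel)"
    using assms by (intro nn_integral_cong) (auto simp: smooth_abs''_eq max_def indicator_def)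
  also have "\<dots> = ennreal (F e - F (-e))"
    using assms F smooth_abs''_bounds[OF assms]
    by (intro nn_integral_FTC_Icc) (auto intro: DERIV_subset)
  also have "F e - F (-e) = 2"
    using assms by (simp add: F_def smooth_abs'_def field_simps power2_eq_square)
  finally show ?thesis by simp
qed

subsection \<open>The discrete Skorokhod decomposition\<close>

definition sgn_sum :: "(nat \<Rightarrow> real) \<Rightarrow> nat \<Rightarrow> real" where
  "sgn_sum x k = (\<Sum>i<k. left_sgn (x i) * (x (Suc i) - x i))"

definition discrete_local_time :: "(nat \<Rightarrow> real) \<Rightarrow> nat \<Rightarrow> real" where
  "discrete_local_time x k = \<bar>x k\<bar> - sgn_sum x k"

text \<open>Skorokhod's formula for the reflection term: the least nondecreasing sequence which,
  added to \<open>sgn_sum x\<close>, stays nonnegative. The index 0 is included, so the maximum is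
  never negative.\<close>

definition reflected_max :: "(nat \<Rightarrow> real) \<Rightarrow> nat \<Rightarrow> real" where
  "reflected_max x k = Max ((\<lambda>j. - sgn_sum x j) ` {..k})"

text \<open>Since \<open>left_sgn (x k) * x k\<close> is |x k|, the old position cancels except for
  its sign. The remaining increment is nonnegative, and positive only after a change of
  sign.\<close>

lemma discrete_local_time_Suc:
  "discrete_local_time x (Suc k) =
    discrete_local_time x k + (\<bar>x (Suc k)\<bar> - left_sgn (x k) * x (Suc k))"
  by (simp add: discrete_local_time_def sgn_sum_def left_sgn_def algebra_simps)

lemma discrete_local_time_mono: "j \<le> k \<Longrightarrow> discrete_local_time x j \<le> discrete_local_time x k"
proof (rule lift_Suc_mono_le[of "discrete_local_time x"])
  show "discrete_local_time x i \<le> discrete_local_time x (Suc i)" for i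
    by (auto simp: discrete_local_time_Suc left_sgn_def)
qed

text \<open>Minimality in Skorokhod's problem: each \<open>- sgn_sum x j\<close> is the local time
  at j minus |x j|, and the local time is monotone.\<close>

lemma reflected_max_le_discrete_local_time: "reflected_max x k \<le> discrete_local_time x k"
proof -
  have "- sgn_sum x j \<le> discrete_local_time x k" if "j \<le> k" for j
    using discrete_local_time_mono[OF that, of x] by (simp add: discrete_local_time_def)
  then show ?thesis by (auto simp: reflected_max_def)
qed

lemma reflected_max_Suc:
  "reflected_max x (Suc k) = max (reflected_max x k) (- sgn_sum x (Suc k))"
  by (simp add: reflected_max_def atMost_Suc max.commute)

text \<open>
  The discrete local time grows only when the path changes sign; right after such a step
  \<open>\<bar>x\<bar>\<close> is at most the size of the step.
\<close>

lemma discrete_local_time_le_reflected_max: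
  assumes "x 0 = 0" "\<And>i. i < k \<Longrightarrow> \<bar>x (Suc i) - x i\<bar> \<le> c" "0 \<le> c"
  shows "discrete_local_time x k \<le> reflected_max x k + c"
  using assms(2)
proof (induction k)
  case 0
  then show ?case
    using assms(1,3) by (simp add: discrete_local_time_def reflected_max_def sgn_sum_def)
next
  case (Suc k)
  show ?case
  proof (cases "left_sgn (x k) * x (Suc k) \<ge> 0")
    case True
    then have "discrete_local_time x (Suc k) = discrete_local_time x k"
      by (auto simp: discrete_local_time_Suc left_sgn_def split: if_splits)
    then show ?thesis using Suc by (simp add: reflected_max_Suc less_SucI max.coboundedI1)
  next
    case False
    then have "\<bar>x (Suc k)\<bar> \<le> \<bar>x (Suc k) - x k\<bar>"
      by (auto simp: left_sgn_def split: if_splits)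
    also have "\<dots> \<le> c" using Suc.prems by simp
    finally show ?thesis by (simp add: reflected_max_Suc discrete_local_time_def)
  qed
qed

section \<open>Pathwise limits along the refining grid\<close>

lemma riemann_sum_tendsto:
  fixes g :: "real \<Rightarrow> real"
  assumes g: "continuous_on {0..t} g" and t: "0 < t"
  shows "(\<lambda>n. \<Sum>i<Suc n. g (real i * (t / Suc n)) * (t / Suc n)) \<longlonglongrightarrow> integral {0..t} g"
proof (rule LIMSEQ_I)
  fix r :: real assume r: "0 < r"
  have "uniformly_continuous_on {0..t} g"
    using g by (intro compact_uniformly_continuous) auto
  then obtain d where d: "0 < d" "\<And>x y. x \<in> {0..t} \<Longrightarrow> y \<in> {0..t} \<Longrightarrow> dist y x < d \<Longrightarrow> dist (g y) (g x) < r / (2 * t)"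
    using r t unfolding uniformly_continuous_on_def
    by (metis divide_pos_pos mult_pos_pos zero_less_numeral)
  have "(\<lambda>n. t / Suc n) \<longlonglongrightarrow> 0" by real_asymp
  then have "\<forall>\<^sub>F n in sequentially. t / Suc n < d"
    by (rule order_tendstoD) (use d in auto)
  then obtain N where N: "\<And>n. n \<ge> N \<Longrightarrow> t / Suc n < d" by (auto simp: eventually_sequentially)
  show "\<exists>N. \<forall>n\<ge>N. norm ((\<Sum>i<Suc n. g (real i * (t / Suc n)) * (t / Suc n)) - integral {0..t} g) < r"
  proof (intro exI[of _ N] allI impI)
    fix n assume n: "N \<le> n"
    define h where "h = t / Suc n"
    have h: "0 < h" "h < d" "h * Suc n = t" using t N[OF n] by (auto simp: h_def)
    define G where "G = (\<lambda>x. integral {0..x} g)"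
    have int: "(\<Sum>i<Suc n. G (real (Suc i) * h) - G (real i * h)) = integral {0..t} g"
    proof -
      have "(\<Sum>i<Suc n. G (real (Suc i) * h) - G (real i * h)) = G (real (Suc n) * h) - G (real 0 * h)"
        by (rule sum_lessThan_telescope)
      also have "real (Suc n) * h = t" using h(3) by (simp only: mult.commute)
      finally show ?thesis by (simp add: G_def)
    qed
    have "\<bar>g (real i * h) * h - (G (real (Suc i) * h) - G (real i * h))\<bar> \<le> r / (2 * t) * h"
      if i: "i < Suc n" for i
    proof -
      have le: "real (Suc i) * h \<le> t"
      proof -
        have "real (Suc i) * h \<le> real (Suc n) * h" using i h by (intro mult_right_mono) auto
        also have "\<dots> = t" using h(3) by (simp only: mult.commute)
        finally show ?thesis .
      qed
      have sub: "{real i * h..real (Suc i) * h} \<subseteq> {0..t}"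
        using le h by auto
      \<comment> \<open>By the mean value theorem the integral over a cell is h * g z for some z in
        it, so the error in each cell compares g at two points less than h apart.\<close>
      have "\<exists>z\<in>{real i * h<..<real (Suc i) * h}.
          G (real (Suc i) * h) - G (real i * h) = (\<lambda>x. x * g z) (real (Suc i) * h - real i * h)"
      proof (rule mvt_simple[where f' = "\<lambda>z x. x * g z"])
        show "real i * h < real (Suc i) * h" using h by simp
        fix x assume "real i * h \<le> x" "x \<le> real (Suc i) * h"
        then have "(G has_vector_derivative g x) (at x within {0..t})"
          unfolding G_def using g sub by (intro integral_has_vector_derivative) auto
        then have "(G has_vector_derivative g x) (at x within {real i * h..real (Suc i) * h})"
          using sub by (rule has_vector_derivative_within_subset)
        then show "(G has_derivative (\<lambda>y. y * g x)) (at x within {real i * h..real (Suc i) * h})"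
          by (simp add: has_vector_derivative_def)
      qed
      then obtain z where z: "z \<in> {real i * h<..<real (Suc i) * h}"
        "G (real (Suc i) * h) - G (real i * h) = h * g z"
        by (auto simp: algebra_simps)
      have "dist (g (real i * h)) (g z) < r / (2 * t)"
      proof (rule d(2))
        show "z \<in> {0..t}" using z sub by auto
        show "real i * h \<in> {0..t}" using z sub by auto
        show "dist (real i * h) z < d" using z h by (auto simp: dist_real_def algebra_simps)
      qed
      then have "h * \<bar>g (real i * h) - g z\<bar> \<le> h * (r / (2 * t))"
        using h by (intro mult_left_mono) (auto simp: dist_real_def)
      moreover have "\<bar>g (real i * h) * h - h * g z\<bar> = h * \<bar>g (real i * h) - g z\<bar>"
        using h by (simp only: mult.commute[of _ h] right_diff_distrib[symmetric] abs_mult)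
      ultimately show ?thesis unfolding z(2) by (simp only: mult.commute)
    qed
    then have "\<bar>\<Sum>i<Suc n. g (real i * h) * h - (G (real (Suc i) * h) - G (real i * h))\<bar>
      \<le> (\<Sum>i<Suc n. r / (2 * t) * h)"
      by (intro order_trans[OF sum_abs] sum_mono) auto
    also have "\<dots> = r / (2 * t) * (h * Suc n)" by simp
    also have "\<dots> < r" using r t h by simp
    finally show "norm ((\<Sum>i<Suc n. g (real i * (t / Suc n)) * (t / Suc n)) - integral {0..t} g) < r"
      unfolding h_def[symmetric] by (simp only: sum_subtractf int[unfolded sum_subtractf] real_norm_def)
  qed
qed

lemma uniform_increments_tendsto_0:
  fixes w :: "real \<Rightarrow> real"
  assumes w: "continuous_on {0..t} w" and t: "0 < t" and r: "0 < r"
  shows "\<forall>\<^sub>F n in sequentially. \<forall>x\<in>{0..t}. \<forall>y\<in>{0..t}. \<bar>x - y\<bar> \<le> t / Suc n \<longrightarrow> \<bar>w x - w y\<bar> < r"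
proof -
  have "uniformly_continuous_on {0..t} w"
    using w by (intro compact_uniformly_continuous) auto
  then obtain d where d: "0 < d" "\<And>x y. x \<in> {0..t} \<Longrightarrow> y \<in> {0..t} \<Longrightarrow> dist y x < d \<Longrightarrow> dist (w y) (w x) < r"
    using r unfolding uniformly_continuous_on_def by metis
  have "(\<lambda>n. t / Suc n) \<longlonglongrightarrow> 0" by real_asymp
  then have "\<forall>\<^sub>F n in sequentially. t / Suc n < d"
    by (rule order_tendstoD) (use d in auto)
  then show ?thesis
    by eventually_elim (use d(2) in \<open>force simp: dist_real_def\<close>)
qed

lemma skeleton_max_tendsto:
  fixes w :: "real \<Rightarrow> real"
  assumes w: "continuous_on {0..t} w" and t: "0 < t"
  shows "(\<lambda>n. Max ((\<lambda>j. w (real j * (t / Suc n))) ` {..Suc n})) \<longlonglongrightarrow> (SUP s\<in>{0..t}. w s)"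
proof (rule LIMSEQ_I)
  fix r :: real assume r: "0 < r"
  have "\<exists>x\<in>{0..t}. \<forall>y\<in>{0..t}. w y \<le> w x"
    using w t by (intro continuous_attains_sup) auto
  then obtain x where x: "x \<in> {0..t}" "\<And>y. y \<in> {0..t} \<Longrightarrow> w y \<le> w x" by blast
  have sup: "(SUP s\<in>{0..t}. w s) = w x"
    by (rule cSup_eq_maximum) (use x in auto)
  obtain N where N: "\<And>n x y. n \<ge> N \<Longrightarrow> x \<in> {0..t} \<Longrightarrow> y \<in> {0..t} \<Longrightarrow> \<bar>x - y\<bar> \<le> t / Suc n \<Longrightarrow> \<bar>w x - w y\<bar> < r"
    using uniform_increments_tendsto_0[OF w t r] unfolding eventually_sequentially by blast
  show "\<exists>N. \<forall>n\<ge>N. norm (Max ((\<lambda>j. w (real j * (t / Suc n))) ` {..Suc n}) - (SUP s\<in>{0..t}. w s)) < r"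
  proof (intro exI[of _ N] allI impI)
    fix n assume n: "N \<le> n"
    define h where "h = t / Suc n"
    have h: "0 < h" "h * Suc n = t" using t by (auto simp: h_def)
    have mem: "real j * h \<in> {0..t}" if "j \<le> Suc n" for j
    proof -
      have "real j * h \<le> real (Suc n) * h" using that h by (intro mult_right_mono) auto
      also have "\<dots> = t" using h(2) by (simp only: mult.commute)
      finally show ?thesis using h by simp
    qed
    have "Max ((\<lambda>j. w (real j * h)) ` {..Suc n}) \<le> w x"
      using x mem by auto
    moreover have "w x - r < Max ((\<lambda>j. w (real j * h)) ` {..Suc n})"
    proof -
      \<comment> \<open>The grid point just to the left of the maximiser x is within one spacing of
        it.\<close>
      define j where "j = nat \<lfloor>x / h\<rfloor>"
      have xh: "0 \<le> x / h" "x / h \<le> Suc n" using x h by (auto simp: field_simps)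
      then have j: "real j \<le> x / h" "x / h < real j + 1" by (auto simp: j_def)
      then have "real j \<le> real (Suc n)" using xh by linarith
      then have jn: "j \<le> Suc n" by (simp only: of_nat_le_iff)
      have "\<bar>x - real j * h\<bar> \<le> h" using j h by (simp add: field_simps abs_le_iff)
      then have "\<bar>w x - w (real j * h)\<bar> < r"
        using N[OF n x(1) mem[OF jn]] by (simp add: h_def)
      moreover have "w (real j * h) \<le> Max ((\<lambda>j. w (real j * h)) ` {..Suc n})"
        using jn by (intro Max_ge) auto
      ultimately show ?thesis by linarith
    qed
    ultimately show "norm (Max ((\<lambda>j. w (real j * (t / Suc n))) ` {..Suc n}) - (SUP s\<in>{0..t}. w s)) < r"
      unfolding sup h_def using r by simp
  qed
qed

subsection \<open>Sign flips of symmetric steps\<close>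

text \<open>Integrate out the last coordinate first: with the others fixed its sign is a constant,
  and the symmetry of N absorbs it. No earlier sign depends on that coordinate, so induction handles
  the rest. Nonnegative integrands make the iterated integrals available without integrability
  conditions.\<close>

lemma nn_integral_sign_flip_PiM:
  fixes N :: "real measure" and s :: "nat \<Rightarrow> (nat \<Rightarrow> real) \<Rightarrow> real"
  assumes N: "prob_space N" and sets_N: "sets N = sets borel" and sym: "distr N borel uminus = N"
    and s: "\<And>i. s i \<in> borel_measurable (\<Pi>\<^sub>M j\<in>{..<i}. borel)" "\<And>i x. s i x \<in> {- 1, 1}"
    and F: "F \<in> borel_measurable (\<Pi>\<^sub>M i\<in>{..<n}. borel)"
  shows "(\<integral>\<^sup>+ x. F (\<lambda>i\<in>{..<n}. s i (restrict x {..<i}) * x i) \<partial>(\<Pi>\<^sub>M i\<in>{..<n}. N))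
    = (\<integral>\<^sup>+ x. F x \<partial>(\<Pi>\<^sub>M i\<in>{..<n}. N))"
  using F
proof (induction n arbitrary: F)
  case 0
  interpret product_sigma_finite "\<lambda>_::nat. N"
    by (simp add: product_sigma_finite_def N prob_space_imp_sigma_finite)
  show ?case using nn_integral_empty[of F] nn_integral_empty[of "\<lambda>_. F (\<lambda>_. undefined)"]
    by (simp add: restrict_def)
next
  case (Suc n)
  interpret N: prob_space N by (rule N)
  interpret P: product_sigma_finite "\<lambda>_::nat. N" ..
  note [measurable_cong] = sets_N
  have cong [measurable_cong]: "sets (\<Pi>\<^sub>M i\<in>I. N) = sets (\<Pi>\<^sub>M i\<in>I. borel)" for I :: "nat set"
    by (intro sets_PiM_cong) (auto simp: sets_N)
  define T where "T n x = (\<lambda>i\<in>{..<n}. s i (restrict x {..<i}) * x i)" for n x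
  have restr: "(\<lambda>x. restrict x {..<i}) \<in> measurable (\<Pi>\<^sub>M i\<in>{..<n}. borel) (\<Pi>\<^sub>M i\<in>{..<i}. borel)"
    if "i \<le> n" for i n :: nat
    using that by (intro measurable_restrict_subset) auto
  have T [measurable]: "T n \<in> measurable (\<Pi>\<^sub>M i\<in>{..<n}. borel) (\<Pi>\<^sub>M i\<in>{..<n}. borel)" for n
    unfolding T_def
  proof (intro measurable_restrict borel_measurable_times)
    fix i assume i: "i \<in> {..<n}"
    then show "(\<lambda>x. s i (restrict x {..<i})) \<in> borel_measurable (\<Pi>\<^sub>M i\<in>{..<n}. borel)"
      using measurable_compose[OF restr s(1), of i n] by simp
    show "(\<lambda>x. x i) \<in> borel_measurable (\<Pi>\<^sub>M i\<in>{..<n}. borel)"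
      using i by measurable
  qed
  have ins: "{..<Suc n} = insert n {..<n}" by auto
  note F = Suc.prems
  have upd [measurable]: "(\<lambda>(x, y). x(n := y)) \<in> measurable ((\<Pi>\<^sub>M i\<in>{..<n}. borel) \<Otimes>\<^sub>M borel) (\<Pi>\<^sub>M i\<in>{..<Suc n}. borel)"
    unfolding ins by (rule measurable_add_dim)
  have [measurable]: "F \<in> borel_measurable (\<Pi>\<^sub>M i\<in>{..<Suc n}. borel)" by (rule F)
  have Fupd: "(\<lambda>y. F (x(n := y))) \<in> borel_measurable borel"
    if "x \<in> space (\<Pi>\<^sub>M i\<in>{..<n}. borel)" for x
    using measurable_compose[OF measurable_compose[OF measurable_Pair1'[OF that] upd] F] by (simp add: fun_upd_def)
  define G where "G x = (\<integral>\<^sup>+ y. F (x(n := y)) \<partial>N)" for x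
  have G [measurable]: "G \<in> borel_measurable (\<Pi>\<^sub>M i\<in>{..<n}. borel)"
    unfolding G_def
  proof (rule N.borel_measurable_nn_integral)
    have "(\<lambda>z. F ((\<lambda>(x, y). x(n := y)) z)) \<in> borel_measurable ((\<Pi>\<^sub>M i\<in>{..<n}. borel) \<Otimes>\<^sub>M borel)"
      by measurable
    then show "(\<lambda>(x, y). F (x(n := y))) \<in> borel_measurable ((\<Pi>\<^sub>M i\<in>{..<n}. borel) \<Otimes>\<^sub>M N)"
      by (simp add: split_beta' cong: measurable_cong_sets)
  qed
  have "(\<integral>\<^sup>+ x. F (T (Suc n) x) \<partial>(\<Pi>\<^sub>M i\<in>{..<Suc n}. N))
    = (\<integral>\<^sup>+ x. \<integral>\<^sup>+ y. F (T (Suc n) (x(n := y))) \<partial>N \<partial>(\<Pi>\<^sub>M i\<in>{..<n}. N))"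
    unfolding ins
    by (rule P.product_nn_integral_insert) (auto simp flip: ins)
  also have "\<dots> = (\<integral>\<^sup>+ x. G (T n x) \<partial>(\<Pi>\<^sub>M i\<in>{..<n}. N))"
  proof (rule nn_integral_cong)
    fix x assume "x \<in> space (\<Pi>\<^sub>M i\<in>{..<n}. N)"
    then have x: "x \<in> space (\<Pi>\<^sub>M i\<in>{..<n}. borel)"
      using sets_eq_imp_space_eq[OF cong] by auto
    then have xr: "restrict x {..<n} = x"
      by (auto simp: space_PiM)
    have Tx: "T n x \<in> space (\<Pi>\<^sub>M i\<in>{..<n}. borel)"
      using measurable_space[OF T x] .
    \<comment> \<open>The sign at an index i \<le> n reads only coordinates below i, so updating
      coordinate n changes nothing but entry n.\<close>
    have T_upd: "T (Suc n) (x(n := y)) = (T n x)(n := s n x * y)" for y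
    proof
      fix i
      have "restrict (x(n := y)) {..<i} = restrict x {..<i}" if "i \<le> n"
        using that by (auto simp: restrict_def fun_eq_iff)
      then show "T (Suc n) (x(n := y)) i = ((T n x)(n := s n x * y)) i"
        using xr by (auto simp: T_def)
    qed
    consider "s n x = 1" | "s n x = - 1" using s(2) by blast
    then show "(\<integral>\<^sup>+ y. F (T (Suc n) (x(n := y))) \<partial>N) = G (T n x)"
    proof cases
      case 1
      then show ?thesis by (simp add: T_upd G_def)
    next
      case 2
      \<comment> \<open>The only use of symmetry: N is replaced by its image under negation.\<close>
      have "G (T n x) = (\<integral>\<^sup>+ y. F ((T n x)(n := y)) \<partial>distr N borel uminus)"
        by (simp add: sym G_def)
      also have "\<dots> = (\<integral>\<^sup>+ y. F ((T n x)(n := - y)) \<partial>N)"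
        using Fupd[OF Tx] by (subst nn_integral_distr) auto
      finally show ?thesis using 2 by (simp add: T_upd)
    qed
  qed
  also have "\<dots> = (\<integral>\<^sup>+ x. G x \<partial>(\<Pi>\<^sub>M i\<in>{..<n}. N))"
    unfolding T_def by (rule Suc.IH) (rule G)
  also have "\<dots> = (\<integral>\<^sup>+ x. F x \<partial>(\<Pi>\<^sub>M i\<in>{..<Suc n}. N))"
    unfolding ins G_def
    by (rule P.product_nn_integral_insert[symmetric]) (auto simp flip: ins)
  finally show ?case unfolding T_def .
qed

text \<open>Independence turns the joint law of the steps into a product measure, where the flips
  are harmless. The functional \<open>G\<close> is arbitrary, so a running maximum
  qualifies.\<close>

lemma (in prob_space) distr_sign_flip:
  fixes \<xi> :: "nat \<Rightarrow> 'a \<Rightarrow> real"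
  assumes indep: "indep_vars (\<lambda>_. borel) \<xi> {..<n}" and n: "0 < n"
    and distr: "\<And>i. i < n \<Longrightarrow> distr M borel (\<xi> i) = N" and sym: "distr N borel uminus = N"
    and s: "\<And>i. s i \<in> borel_measurable (\<Pi>\<^sub>M j\<in>{..<i}. borel)" "\<And>i x. s i x \<in> {- 1, 1 :: real}"
    and G [measurable]: "G \<in> borel_measurable (\<Pi>\<^sub>M i\<in>{..<n}. borel)"
  shows "distr M borel (\<lambda>\<omega>. G (\<lambda>i\<in>{..<n}. s i (\<lambda>j\<in>{..<i}. \<xi> j \<omega>) * \<xi> i \<omega>) :: real)
    = distr M borel (\<lambda>\<omega>. G (\<lambda>i\<in>{..<n}. \<xi> i \<omega>))"
proof -
  have \<xi>: "random_variable borel (\<xi> i)" if "i < n" for i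
    using indep that by (auto simp: indep_vars_def)
  have [measurable]: "(\<lambda>\<omega>. \<lambda>i\<in>{..<k}. \<xi> i \<omega>) \<in> measurable M (\<Pi>\<^sub>M i\<in>{..<k}. borel)" if "k \<le> n" for k
    using that \<xi> by (intro measurable_restrict) auto
  have T [measurable]: "(\<lambda>x. \<lambda>i\<in>{..<n}. s i (restrict x {..<i}) * x i) \<in> measurable (\<Pi>\<^sub>M i\<in>{..<n}. borel) (\<Pi>\<^sub>M i\<in>{..<n}. borel)"
  proof (intro measurable_restrict borel_measurable_times)
    fix i assume i: "i \<in> {..<n}"
    then show "(\<lambda>x. s i (restrict x {..<i})) \<in> borel_measurable (\<Pi>\<^sub>M i\<in>{..<n}. borel)"
      by (intro measurable_compose[OF _ s(1)] measurable_restrict_subset) auto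
    show "(\<lambda>x. x i) \<in> borel_measurable (\<Pi>\<^sub>M i\<in>{..<n}. borel)"
      using i by measurable
  qed
  \<comment> \<open>Because 0 < n, N is the law of an actual step and so a Borel probability
    measure.\<close>
  have N: "prob_space N" "sets N = sets borel"
    using distr[OF n] \<xi>[OF n] prob_space_distr by (metis, metis sets_distr)
  have law: "distr M (\<Pi>\<^sub>M i\<in>{..<n}. borel) (\<lambda>\<omega>. \<lambda>i\<in>{..<n}. \<xi> i \<omega>) = (\<Pi>\<^sub>M i\<in>{..<n}. N)"
  proof -
    have "distr M (\<Pi>\<^sub>M i\<in>{..<n}. borel) (\<lambda>\<omega>. \<lambda>i\<in>{..<n}. \<xi> i \<omega>) = (\<Pi>\<^sub>M i\<in>{..<n}. distr M borel (\<xi> i))"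
      using indep_vars_iff_distr_eq_PiM'[where I = "{..<n}" and M' = "\<lambda>_. borel" and X = \<xi>] n \<xi> indep by auto
    also have "\<dots> = (\<Pi>\<^sub>M i\<in>{..<n}. N)"
      using distr by (intro PiM_cong) auto
    finally show ?thesis .
  qed
  have eq: "(\<lambda>i\<in>{..<n}. s i (\<lambda>j\<in>{..<i}. \<xi> j \<omega>) * \<xi> i \<omega>)
    = (\<lambda>x. \<lambda>i\<in>{..<n}. s i (restrict x {..<i}) * x i) (\<lambda>i\<in>{..<n}. \<xi> i \<omega>)" for \<omega>
  proof -
    have "(\<lambda>j\<in>{..<i}. \<xi> j \<omega>) = restrict (\<lambda>j\<in>{..<n}. \<xi> j \<omega>) {..<i}" if "i < n" for i
      using that by (auto simp: fun_eq_iff)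
    then show ?thesis by (intro restrict_ext) (simp del: restrict_restrict)
  qed
  have [measurable]: "(\<lambda>\<omega>. G (\<lambda>i\<in>{..<n}. s i (\<lambda>j\<in>{..<i}. \<xi> j \<omega>) * \<xi> i \<omega>)) \<in> borel_measurable M"
    unfolding eq by (rule measurable_compose[OF _ measurable_compose[OF T G]]) simp
  show ?thesis
  proof (rule measure_eqI)
    fix A assume "A \<in> sets (distr M borel (\<lambda>\<omega>. G (\<lambda>i\<in>{..<n}. s i (\<lambda>j\<in>{..<i}. \<xi> j \<omega>) * \<xi> i \<omega>) :: real))"
    then have A [measurable]: "A \<in> sets borel" by simp
    have "emeasure (distr M borel (\<lambda>\<omega>. G (\<lambda>i\<in>{..<n}. s i (\<lambda>j\<in>{..<i}. \<xi> j \<omega>) * \<xi> i \<omega>))) A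
      = (\<integral>\<^sup>+ \<omega>. indicator A (G (\<lambda>i\<in>{..<n}. s i (\<lambda>j\<in>{..<i}. \<xi> j \<omega>) * \<xi> i \<omega>)) \<partial>M)"
      by (subst nn_integral_distr[symmetric, where f = "indicator A" and M' = borel]) auto
    also have "\<dots> = (\<integral>\<^sup>+ x. indicator A (G (\<lambda>i\<in>{..<n}. s i (restrict x {..<i}) * x i))
        \<partial>(\<Pi>\<^sub>M i\<in>{..<n}. N))"
      unfolding eq law[symmetric] by (subst nn_integral_distr) auto
    also have "\<dots> = (\<integral>\<^sup>+ x. indicator A (G x) \<partial>(\<Pi>\<^sub>M i\<in>{..<n}. N))"
      by (rule nn_integral_sign_flip_PiM[OF N sym s, where F = "\<lambda>x. indicator A (G x)"]) measurable
    also have "\<dots> = (\<integral>\<^sup>+ \<omega>. indicator A (G (\<lambda>i\<in>{..<n}. \<xi> i \<omega>)) \<partial>M)"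
      unfolding law[symmetric] by (subst nn_integral_distr) auto
    also have "\<dots> = emeasure (distr M borel (\<lambda>\<omega>. G (\<lambda>i\<in>{..<n}. \<xi> i \<omega>))) A"
      by (subst nn_integral_distr[symmetric, where f = "indicator A" and M' = borel]) auto
    finally show "emeasure (distr M borel (\<lambda>\<omega>. G (\<lambda>i\<in>{..<n}. s i (\<lambda>j\<in>{..<i}. \<xi> j \<omega>) * \<xi> i \<omega>))) A
      = emeasure (distr M borel (\<lambda>\<omega>. G (\<lambda>i\<in>{..<n}. \<xi> i \<omega>))) A" .
  qed simp
qed

text \<open>The flip of step i is minus the sign of the position before it, a function of earlier
  steps. The partial sums of the flipped steps are then \<open>- sgn_sum\<close>, whose maximum is
  the left side; the unflipped ones give the walk itself.\<close>

lemma (in prob_space) distr_reflected_max: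
  fixes X :: "nat \<Rightarrow> 'a \<Rightarrow> real"
  assumes X0: "\<And>\<omega>. X 0 \<omega> = 0"
    and indep: "indep_vars (\<lambda>_. borel) (\<lambda>i \<omega>. X (Suc i) \<omega> - X i \<omega>) {..<n}" and n: "0 < n"
    and distr: "\<And>i. i < n \<Longrightarrow> distr M borel (\<lambda>\<omega>. X (Suc i) \<omega> - X i \<omega>) = N"
    and sym: "distr N borel uminus = N"
  shows "distr M borel (\<lambda>\<omega>. reflected_max (\<lambda>i. X i \<omega>) n)
    = distr M borel (\<lambda>\<omega>. Max ((\<lambda>j. X j \<omega>) ` {..n}))"
proof -
  define \<xi> where "\<xi> i \<omega> = X (Suc i) \<omega> - X i \<omega>" for i \<omega>
  define s where "s i x = - left_sgn (\<Sum>j<i. x j)" for i :: nat and x :: "nat \<Rightarrow> real"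
  define G where "G x = Max ((\<lambda>j. \<Sum>i<j. x i) ` {..n})" for x :: "nat \<Rightarrow> real"
  have X: "X i \<omega> = (\<Sum>j<i. \<xi> j \<omega>)" for i \<omega>
    using sum_lessThan_telescope[of "\<lambda>i. X i \<omega>" i] by (simp add: \<xi>_def X0)
  have "s i \<in> borel_measurable (\<Pi>\<^sub>M j\<in>{..<i}. borel)" for i
    unfolding s_def by measurable
  moreover have "s i x \<in> {- 1, 1}" for i x by (simp add: s_def left_sgn_def)
  moreover have "G \<in> borel_measurable (\<Pi>\<^sub>M i\<in>{..<n}. borel)"
    unfolding G_def by (intro borel_measurable_Max borel_measurable_sum) auto
  ultimately have "distr M borel (\<lambda>\<omega>. G (\<lambda>i\<in>{..<n}. s i (\<lambda>j\<in>{..<i}. \<xi> j \<omega>) * \<xi> i \<omega>))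
    = distr M borel (\<lambda>\<omega>. G (\<lambda>i\<in>{..<n}. \<xi> i \<omega>))"
    using indep distr by (intro distr_sign_flip[OF _ n _ sym]) (simp_all add: \<xi>_def)
  moreover have "G (\<lambda>i\<in>{..<n}. s i (\<lambda>j\<in>{..<i}. \<xi> j \<omega>) * \<xi> i \<omega>) = reflected_max (\<lambda>i. X i \<omega>) n" for \<omega>
    unfolding G_def reflected_max_def sgn_sum_def
    by (intro arg_cong[where f = Max] image_cong refl)
      (auto simp: s_def X sum_negf[symmetric] intro!: sum.cong)
  moreover have "G (\<lambda>i\<in>{..<n}. \<xi> i \<omega>) = Max ((\<lambda>j. X j \<omega>) ` {..n})" for \<omega>
    unfolding G_def X by (intro arg_cong[where f = Max] image_cong refl) auto
  ultimately show ?thesis by simp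
qed

section \<open>The density at zero as a limit of mollified occupation integrals\<close>

text \<open>Half the kernel is a probability density supported within 1 / (m + 1) of 0, so its
  average of l tends to l 0 by continuity.\<close>

lemma occupation_density_limit:
  fixes w l :: "real \<Rightarrow> real"
  assumes w: "continuous_on {0..t} w" and l: "continuous_on UNIV l" "\<And>x. 0 \<le> l x"
    and occ: "\<And>A. A \<in> sets borel \<Longrightarrow>
      (\<integral>\<^sup>+ s\<in>{0..t}. indicator A (w s) \<partial>lborel) = (\<integral>\<^sup>+ x\<in>A. ennreal (l x) \<partial>lborel)"
  shows "(\<lambda>m. integral {0..t} (\<lambda>s. smooth_abs'' (1 / Suc m) (w s)) / 2) \<longlonglongrightarrow> l 0"
proof -
  let ?R = "restrict_space lborel {0..t}"
  have wm [measurable]: "w \<in> borel_measurable ?R"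
    using borel_measurable_continuous_on_restrict[OF w]
    by (simp cong: measurable_cong_sets add: sets_restrict_space)
  have lm [measurable]: "l \<in> borel_measurable borel"
    using l(1) by (rule borel_measurable_continuous_onI)
  \<comment> \<open>The occupation formula on indicators says that the path pushes Lebesgue measure
    on [0, t] forward to the density l. In this form it extends to every nonnegative Borel
    integrand.\<close>
  have occ': "distr ?R borel w = density lborel (\<lambda>x. ennreal (l x))"
  proof (rule measure_eqI)
    fix A assume "A \<in> sets (distr ?R borel w)"
    then have A [measurable]: "A \<in> sets borel" by simp
    have "emeasure (distr ?R borel w) A = (\<integral>\<^sup>+ s. indicator A (w s) \<partial>?R)"
      by (subst nn_integral_distr[symmetric, where f = "indicator A" and M' = borel]) auto
    also have "\<dots> = (\<integral>\<^sup>+ s\<in>{0..t}. indicator A (w s) \<partial>lborel)"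
      by (subst nn_integral_restrict_space) auto
    also have "\<dots> = emeasure (density lborel (\<lambda>x. ennreal (l x))) A"
      using occ[OF A] by (simp add: emeasure_density)
    finally show "emeasure (distr ?R borel w) A = emeasure (density lborel (\<lambda>x. ennreal (l x))) A" .
  qed simp
  have key: "ennreal (integral {0..t} (\<lambda>s. smooth_abs'' e (w s)))
    = (\<integral>\<^sup>+ x. ennreal (l x) * ennreal (smooth_abs'' e x) \<partial>lborel)" if e: "0 < e" for e
  proof -
    have c: "continuous_on {0..t} (\<lambda>s. smooth_abs'' e (w s))"
      using continuous_on_compose2[OF continuous_smooth_abs''[of UNIV] w] by simp
    have "(\<integral>\<^sup>+ x. ennreal (l x) * ennreal (smooth_abs'' e x) \<partial>lborel)
      = (\<integral>\<^sup>+ x. ennreal (smooth_abs'' e x) \<partial>distr ?R borel w)"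
      unfolding occ' by (subst nn_integral_density) auto
    also have "\<dots> = (\<integral>\<^sup>+ s. ennreal (smooth_abs'' e (w s)) \<partial>?R)"
      by (subst nn_integral_distr) auto
    also have "\<dots> = (\<integral>\<^sup>+ s. ennreal (indicator {0..t} s * smooth_abs'' e (w s)) \<partial>lborel)"
      by (subst nn_integral_restrict_space) (auto intro!: nn_integral_cong simp: indicator_def)
    also have "\<dots> = ennreal (integral {0..t} (\<lambda>s. smooth_abs'' e (w s)))"
    proof (rule nn_integral_has_integral_lborel)
      show "(\<lambda>s. indicator {0..t} s * smooth_abs'' e (w s)) \<in> borel_measurable borel"
        using borel_measurable_continuous_on_indicator[OF _ c] by simp
      show "0 \<le> indicator {0..t} s * smooth_abs'' e (w s)" for s
        using smooth_abs''_bounds[OF e] by simp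
      have "((\<lambda>s. smooth_abs'' e (w s)) has_integral integral {0..t} (\<lambda>s. smooth_abs'' e (w s))) {0..t}"
        using c by (intro integrable_integral integrable_continuous_real)
      then have "((\<lambda>s. if s \<in> {0..t} then smooth_abs'' e (w s) else 0) has_integral
          integral {0..t} (\<lambda>s. smooth_abs'' e (w s))) UNIV"
        by (simp only: has_integral_restrict_UNIV)
      then show "((\<lambda>s. indicator {0..t} s * smooth_abs'' e (w s)) has_integral
          integral {0..t} (\<lambda>s. smooth_abs'' e (w s))) UNIV"
        by (rule has_integral_eq[rotated]) (auto simp: indicator_def)
    qed
    finally show ?thesis by simp
  qed
  have nonneg: "0 \<le> integral {0..t} (\<lambda>s. smooth_abs'' e (w s))" if "0 < e" for e
  proof (rule integral_nonneg)
    show "(\<lambda>s. smooth_abs'' e (w s)) integrable_on {0..t}"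
      using continuous_on_compose2[OF continuous_smooth_abs''[of UNIV] w]
      by (intro integrable_continuous_real) simp
  qed (use smooth_abs''_bounds[OF that] in auto)
  show ?thesis
  proof (rule LIMSEQ_I)
    fix r :: real assume r: "0 < r"
    have "isCont l 0" using l(1) by (simp add: continuous_on_eq_continuous_at)
    then obtain d where d: "0 < d" "\<And>x. \<bar>x\<bar> < d \<Longrightarrow> \<bar>l x - l 0\<bar> < r / 2"
      using r unfolding continuous_at_eps_delta by (metis diff_zero half_gt_zero dist_real_def)
    have "(\<lambda>m. 1 / real (Suc m)) \<longlonglongrightarrow> 0" by real_asymp
    then have "\<forall>\<^sub>F m in sequentially. 1 / real (Suc m) < d"
      by (rule order_tendstoD) (use d in auto)
    then obtain K where K: "\<And>m. m \<ge> K \<Longrightarrow> 1 / real (Suc m) < d" by (auto simp: eventually_sequentially)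
    show "\<exists>K. \<forall>m\<ge>K. norm (integral {0..t} (\<lambda>s. smooth_abs'' (1 / Suc m) (w s)) / 2 - l 0) < r"
    proof (intro exI[of _ K] allI impI)
      fix m assume m: "K \<le> m"
      define e where "e = 1 / real (Suc m)"
      have e: "0 < e" "e < d" using K[OF m] by (auto simp: e_def)
      define I where "I = integral {0..t} (\<lambda>s. smooth_abs'' e (w s))"
      have I0: "0 \<le> I" using nonneg[OF e(1)] by (simp add: I_def)
      have z: "smooth_abs'' e x = 0" if "\<not> \<bar>x\<bar> < d" for x
        using that e by (simp add: smooth_abs''_eq)
      have const: "(\<integral>\<^sup>+ x. ennreal c * ennreal (smooth_abs'' e x) \<partial>lborel) = ennreal (2 * c)"
        if "0 \<le> c" for c
        using that by (simp add: nn_integral_cmult nn_integral_smooth_abs''[OF e(1)] ennreal_mult mult.commute)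
      have near: "l x \<le> l 0 + r / 2" "l 0 - r / 2 \<le> l x" if "\<bar>x\<bar> < d" for x
        using d(2)[OF that] by linarith+
      have "ennreal I \<le> (\<integral>\<^sup>+ x. ennreal (l 0 + r / 2) * ennreal (smooth_abs'' e x) \<partial>lborel)"
        unfolding I_def key[OF e(1)]
      proof (rule nn_integral_mono)
        fix x
        show "ennreal (l x) * ennreal (smooth_abs'' e x) \<le> ennreal (l 0 + r / 2) * ennreal (smooth_abs'' e x)"
          using near[of x] z[of x] by (cases "\<bar>x\<bar> < d") (auto intro!: mult_right_mono ennreal_leI)
      qed
      also have "\<dots> = ennreal (2 * (l 0 + r / 2))"
        using l(2)[of 0] r by (intro const) auto
      finally have up: "I \<le> 2 * (l 0 + r / 2)"
        using l(2)[of 0] r by (subst (asm) ennreal_le_iff) auto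
      \<comment> \<open>The lower bound may be negative whereas \<open>const\<close> requires a
        nonnegative factor, hence the truncation at 0; it is harmless as l is nonnegative.\<close>
      have "ennreal (2 * (l 0 - r / 2)) \<le> ennreal (2 * max 0 (l 0 - r / 2))"
        by (intro ennreal_leI mult_left_mono) auto
      also have "\<dots> = (\<integral>\<^sup>+ x. ennreal (max 0 (l 0 - r / 2)) * ennreal (smooth_abs'' e x) \<partial>lborel)"
        by (intro const[symmetric]) auto
      also have "\<dots> \<le> ennreal I"
        unfolding I_def key[OF e(1)]
      proof (rule nn_integral_mono)
        fix x
        show "ennreal (max 0 (l 0 - r / 2)) * ennreal (smooth_abs'' e x) \<le> ennreal (l x) * ennreal (smooth_abs'' e x)"
          using near[of x] z[of x] l(2)[of x]
          by (cases "\<bar>x\<bar> < d") (auto intro!: mult_right_mono ennreal_leI)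
      qed
      finally have lo: "2 * (l 0 - r / 2) \<le> I"
        using I0 by (subst (asm) ennreal_le_iff) auto
      show "norm (integral {0..t} (\<lambda>s. smooth_abs'' (1 / Suc m) (w s)) / 2 - l 0) < r"
        using up lo r unfolding e_def[symmetric] I_def[symmetric] by (simp add: abs_less_iff)
    qed
  qed
qed

subsection \<open>Moment estimates for Gaussian walks\<close>

text \<open>The walk starts at 0 at every sample point, so it is exactly the sum of its steps. The
  laws of steps and positions are both listed because for a sampled Wiener process each is an
  instance of \<open>normal_increments\<close>.\<close>

locale gaussian_walk = prob_space M for M :: "'a measure" +
  fixes X :: "nat \<Rightarrow> 'a \<Rightarrow> real" and n :: nat and \<delta> :: real
  assumes X_0: "X 0 \<omega> = 0" and \<delta>_pos: "0 < \<delta>"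
    and indep_steps: "indep_vars (\<lambda>_. borel) (\<lambda>i \<omega>. X (Suc i) \<omega> - X i \<omega>) {..<n}"
    and step_distributed: "i < n \<Longrightarrow>
      distributed M lborel (\<lambda>\<omega>. X (Suc i) \<omega> - X i \<omega>) (normal_density 0 (sqrt \<delta>))"
    and position_distributed: "0 < i \<Longrightarrow> i \<le> n \<Longrightarrow>
      distributed M lborel (X i) (normal_density 0 (sqrt (real i * \<delta>)))"
begin

definition step :: "nat \<Rightarrow> 'a \<Rightarrow> real" where
  "step i \<omega> = X (Suc i) \<omega> - X i \<omega>"

lemma X_eq_sum_step: "X i \<omega> = (\<Sum>j<i. step j \<omega>)"
  using sum_lessThan_telescope[of "\<lambda>i. X i \<omega>" i] by (simp add: step_def X_0)

lemma step_measurable [measurable]: "i < n \<Longrightarrow> step i \<in> borel_measurable M"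
  using distributed_measurable[OF step_distributed, of i] by (simp add: step_def[abs_def])

lemma X_measurable: "i \<le> n \<Longrightarrow> X i \<in> borel_measurable M"
  by (subst measurable_cong[OF X_eq_sum_step], intro borel_measurable_sum step_measurable) auto

lemma indep_past_step:
  assumes "k < n" "A \<in> borel_measurable (\<Pi>\<^sub>M i\<in>{..<k}. borel)" "B \<in> borel_measurable borel"
  shows "indep_var borel (\<lambda>\<omega>. A (\<lambda>i\<in>{..<k}. step i \<omega>) :: real) borel (\<lambda>\<omega>. B (step k \<omega>) :: real)"
proof -
  have "indep_vars (\<lambda>_. borel) step {..<n}"
    using indep_steps by (simp add: step_def[abs_def])
  then have "indep_var (\<Pi>\<^sub>M i\<in>{..<k}. borel) (\<lambda>\<omega>. \<lambda>i\<in>{..<k}. step i \<omega>)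
      (\<Pi>\<^sub>M i\<in>{k}. borel) (\<lambda>\<omega>. \<lambda>i\<in>{k}. step i \<omega>)"
    using assms(1) by (intro indep_var_restrict) auto
  moreover have "(\<lambda>x. B (x k)) \<in> borel_measurable (\<Pi>\<^sub>M i\<in>{k}. borel)"
    using assms(3) by measurable
  ultimately have "indep_var borel (A \<circ> (\<lambda>\<omega>. \<lambda>i\<in>{..<k}. step i \<omega>))
      borel ((\<lambda>x. B (x k)) \<circ> (\<lambda>\<omega>. \<lambda>i\<in>{k}. step i \<omega>))"
    using assms(2) by (intro indep_var_compose)
  then show ?thesis by (simp add: comp_def)
qed

text \<open>Orthogonality of martingale differences. It serves twice: for the steps themselves and
  for their centred squares, with \<phi> x = x^2 - \<delta>. Integrability is part of the conclusion
  because the induction step needs it for the partial sum.\<close>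

lemma martingale_sum_second_moment:
  fixes h \<phi> :: "real \<Rightarrow> real"
  assumes h [measurable]: "h \<in> borel_measurable borel" and hC: "\<And>x. \<bar>h x\<bar> \<le> C"
    and \<phi> [measurable]: "\<phi> \<in> borel_measurable borel"
    and \<phi>1: "\<And>i. i < n \<Longrightarrow> integrable M (\<lambda>\<omega>. \<phi> (step i \<omega>))" "\<And>i. i < n \<Longrightarrow> expectation (\<lambda>\<omega>. \<phi> (step i \<omega>)) = 0"
    and \<phi>2: "\<And>i. i < n \<Longrightarrow> integrable M (\<lambda>\<omega>. (\<phi> (step i \<omega>))\<^sup>2)"
      "\<And>i. i < n \<Longrightarrow> expectation (\<lambda>\<omega>. (\<phi> (step i \<omega>))\<^sup>2) = v"
    and k: "k \<le> n"
  shows "integrable M (\<lambda>\<omega>. \<Sum>i<k. h (X i \<omega>) * \<phi> (step i \<omega>)) \<and>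
    integrable M (\<lambda>\<omega>. (\<Sum>i<k. h (X i \<omega>) * \<phi> (step i \<omega>))\<^sup>2) \<and>
    expectation (\<lambda>\<omega>. (\<Sum>i<k. h (X i \<omega>) * \<phi> (step i \<omega>))\<^sup>2)
      = (\<Sum>i<k. expectation (\<lambda>\<omega>. (h (X i \<omega>))\<^sup>2) * v)"
  using k
proof (induction k)
  case 0
  then show ?case by simp
next
  case (Suc k)
  then have k: "k < n" by simp
  define S where "S \<omega> = (\<Sum>i<k. h (X i \<omega>) * \<phi> (step i \<omega>))" for \<omega>
  have IH: "integrable M S" "integrable M (\<lambda>\<omega>. (S \<omega>)\<^sup>2)"
      "expectation (\<lambda>\<omega>. (S \<omega>)\<^sup>2) = (\<Sum>i<k. expectation (\<lambda>\<omega>. (h (X i \<omega>))\<^sup>2) * v)"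
    using Suc by (auto simp: S_def[abs_def])
  have [measurable]: "X k \<in> borel_measurable M" "step k \<in> borel_measurable M"
    using k by (auto intro: X_measurable)
  have [measurable]: "S \<in> borel_measurable M" using IH by auto
  \<comment> \<open>Positions up to k are written as functions of the first k steps, a block
    disjoint from step k.\<close>
  define x where "x i y = (\<Sum>j<i. y j)" for i and y :: "nat \<Rightarrow> real"
  have x [measurable]: "x i \<in> borel_measurable (\<Pi>\<^sub>M j\<in>{..<k}. borel)" if "i \<le> k" for i
    unfolding x_def using that by (intro borel_measurable_sum measurable_component_singleton) auto
  have Xx: "X i \<omega> = x i (\<lambda>j\<in>{..<k}. step j \<omega>)" if "i \<le> k" for i \<omega>
    using that by (auto simp: X_eq_sum_step x_def intro!: sum.cong)
  have indep: "indep_var borel (\<lambda>\<omega>. (h (X k \<omega>))\<^sup>2) borel (\<lambda>\<omega>. (\<phi> (step k \<omega>))\<^sup>2)"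
  proof -
    have "(\<lambda>y. (h (x k y))\<^sup>2) \<in> borel_measurable (\<Pi>\<^sub>M j\<in>{..<k}. borel)" by measurable
    from indep_past_step[OF k this, of "\<lambda>y. (\<phi> y)\<^sup>2"] show ?thesis by (simp add: Xx)
  qed
  have indep': "indep_var borel (\<lambda>\<omega>. S \<omega> * h (X k \<omega>)) borel (\<lambda>\<omega>. \<phi> (step k \<omega>))"
  proof -
    have "(\<lambda>y. h (x i y) * \<phi> (y i)) \<in> borel_measurable (\<Pi>\<^sub>M j\<in>{..<k}. borel)" if "i < k" for i
      using that by (intro borel_measurable_times measurable_compose[OF _ h] measurable_compose[OF _ \<phi>] x
        measurable_component_singleton) auto
    then have "(\<lambda>y. (\<Sum>i<k. h (x i y) * \<phi> (y i)) * h (x k y)) \<in> borel_measurable (\<Pi>\<^sub>M j\<in>{..<k}. borel)"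
      by (intro borel_measurable_times borel_measurable_sum measurable_compose[OF _ h] x) auto
    from indep_past_step[OF k this, of \<phi>] show ?thesis by (simp add: Xx S_def)
  qed
  have bdd: "integrable M (\<lambda>\<omega>. (h (X k \<omega>))\<^sup>2)"
  proof (rule integrable_const_bound)
    show "AE \<omega> in M. norm ((h (X k \<omega>))\<^sup>2) \<le> C\<^sup>2"
      using abs_le_square_iff[of "h _" C] hC order_trans[OF abs_ge_zero hC] by (intro AE_I2) auto
  qed measurable
  have Sh: "integrable M (\<lambda>\<omega>. S \<omega> * h (X k \<omega>))"
  proof (rule Bochner_Integration.integrable_bound[OF integrable_mult_right[OF IH(1), of C]])
    have "\<bar>h (X k \<omega>)\<bar> \<le> \<bar>C\<bar>" for \<omega> using hC[of "X k \<omega>"] by linarith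
    then show "AE \<omega> in M. norm (S \<omega> * h (X k \<omega>)) \<le> norm (C * S \<omega>)"
      by (intro AE_I2) (simp add: abs_mult mult.commute[of "\<bar>C\<bar>"] mult_left_mono)
  qed measurable
  note int = indep_var_integrable[OF indep bdd \<phi>2(1)[OF k]] indep_var_integrable[OF indep' Sh \<phi>1(1)[OF k]]
  have h\<phi>: "integrable M (\<lambda>\<omega>. h (X k \<omega>) * \<phi> (step k \<omega>))"
  proof (rule Bochner_Integration.integrable_bound[OF integrable_mult_right[OF \<phi>1(1)[OF k], of C]])
    have "\<bar>h (X k \<omega>)\<bar> \<le> \<bar>C\<bar>" for \<omega> using hC[of "X k \<omega>"] by linarith
    then show "AE \<omega> in M. norm (h (X k \<omega>) * \<phi> (step k \<omega>)) \<le> norm (C * \<phi> (step k \<omega>))"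
      by (intro AE_I2) (simp add: abs_mult mult_right_mono)
  qed measurable
  \<comment> \<open>The cross term has mean 0, since \<open>\<phi> (step k \<omega>)\<close> is
    centred and independent of its other factor; the expectation of the last term
    factorises.\<close>
  have sq: "(\<Sum>i<Suc k. h (X i \<omega>) * \<phi> (step i \<omega>))\<^sup>2
    = (S \<omega>)\<^sup>2 + (2 * (S \<omega> * h (X k \<omega>) * \<phi> (step k \<omega>)) + (h (X k \<omega>))\<^sup>2 * (\<phi> (step k \<omega>))\<^sup>2)" for \<omega>
    by (simp add: S_def[symmetric] power2_eq_square algebra_simps)
  show ?case
    unfolding sq
    using IH int h\<phi> \<phi>1(2)[OF k] \<phi>2(2)[OF k]
      indep_var_lebesgue_integral[OF indep bdd \<phi>2(1)[OF k]] indep_var_lebesgue_integral[OF indep' Sh \<phi>1(1)[OF k]]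
    by (simp add: S_def[symmetric])
qed

text \<open>Cauchy-Schwarz, read off from the nonnegative variance of |S|.\<close>

lemma expectation_abs_le_sqrt:
  assumes S: "integrable M S" "integrable M (\<lambda>\<omega>. (S \<omega>)\<^sup>2)" "expectation (\<lambda>\<omega>. (S \<omega>)\<^sup>2) \<le> v"
  shows "expectation (\<lambda>\<omega>. \<bar>S \<omega>\<bar> :: real) \<le> sqrt v"
proof (rule real_le_rsqrt)
  have "0 \<le> variance (\<lambda>\<omega>. \<bar>S \<omega>\<bar>)" by (rule variance_positive)
  also have "\<dots> = expectation (\<lambda>\<omega>. (S \<omega>)\<^sup>2) - (expectation (\<lambda>\<omega>. \<bar>S \<omega>\<bar>))\<^sup>2"
    using S by (subst variance_eq) auto
  finally show "(expectation (\<lambda>\<omega>. \<bar>S \<omega>\<bar>))\<^sup>2 \<le> v" using S(3) by linarith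
qed

lemma step_moments:
  assumes i: "i < n"
  shows "integrable M (step i)" "expectation (step i) = 0"
    "integrable M (\<lambda>\<omega>. (step i \<omega>)\<^sup>2)" "expectation (\<lambda>\<omega>. (step i \<omega>)\<^sup>2) = \<delta>"
    "integrable M (\<lambda>\<omega>. ((step i \<omega>)\<^sup>2 - \<delta>)\<^sup>2)" "expectation (\<lambda>\<omega>. ((step i \<omega>)\<^sup>2 - \<delta>)\<^sup>2) = 2 * \<delta>\<^sup>2"
    "integrable M (\<lambda>\<omega>. \<bar>step i \<omega>\<bar>^3)" "expectation (\<lambda>\<omega>. \<bar>step i \<omega>\<bar>^3) \<le> 2 * \<delta> * sqrt \<delta>"
proof -
  define \<sigma> where "\<sigma> = sqrt \<delta>"
  have \<sigma>: "0 < \<sigma>" "\<sigma>\<^sup>2 = \<delta>" using \<delta>_pos by (auto simp: \<sigma>_def)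
  have D: "distributed M lborel (step i) (normal_density 0 \<sigma>)"
    using step_distributed[OF i] by (simp add: step_def[abs_def] \<sigma>_def)
  note int = distributed_integrable[OF D] and exp = distributed_integral[OF D]
  have pw: "integrable M (\<lambda>\<omega>. step i \<omega> ^ k)" for k
    using integrable_normal_moment[OF \<sigma>(1), of 0 k] int[of "\<lambda>x. x ^ k"] by simp
  \<comment> \<open>For k = 1 and k = 2 this yields \<delta> and 3 \<delta>^2, whence the variance 2
    \<delta>^2 of the squared step.\<close>
  have even: "expectation (\<lambda>\<omega>. step i \<omega> ^ (2 * k)) = fact (2 * k) / ((2 / \<delta>)^k * fact k)" for k
    using integral_normal_moment_even[OF \<sigma>(1), of 0 k] exp[of "\<lambda>x. x ^ (2 * k)"] by (simp add: \<sigma>)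
  show "integrable M (step i)" using pw[of 1] by simp
  show "expectation (step i) = 0"
    using integral_normal_moment_odd[OF \<sigma>(1), of 0 0] exp[of "\<lambda>x. x"] by simp
  show sq: "integrable M (\<lambda>\<omega>. (step i \<omega>)\<^sup>2)" by (rule pw)
  show e2: "expectation (\<lambda>\<omega>. (step i \<omega>)\<^sup>2) = \<delta>"
    using even[of 1] by simp
  have e4: "expectation (\<lambda>\<omega>. (step i \<omega>)^4) = 3 * \<delta>\<^sup>2"
    using even[of 2] \<delta>_pos by (simp add: fact_numeral field_simps)
  have eq: "((step i \<omega>)\<^sup>2 - \<delta>)\<^sup>2 = (step i \<omega>)^4 - 2 * \<delta> * (step i \<omega>)\<^sup>2 + \<delta>\<^sup>2" for \<omega>
    by (simp add: power2_eq_square algebra_simps eval_nat_numeral)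
  show "integrable M (\<lambda>\<omega>. ((step i \<omega>)\<^sup>2 - \<delta>)\<^sup>2)" unfolding eq using pw[of 4] sq by simp
  show "expectation (\<lambda>\<omega>. ((step i \<omega>)\<^sup>2 - \<delta>)\<^sup>2) = 2 * \<delta>\<^sup>2"
    unfolding eq using pw[of 4] sq e2 e4 by (simp add: prob_space power2_eq_square)
  show "integrable M (\<lambda>\<omega>. \<bar>step i \<omega>\<bar>^3)"
    using integrable_normal_moment_abs[OF \<sigma>(1), of 0 3] int[of "\<lambda>x. \<bar>x\<bar>^3"] by simp
  have "expectation (\<lambda>\<omega>. \<bar>step i \<omega>\<bar>^3) = 2 * \<sigma>^3 * sqrt (2 / pi)"
    using integral_normal_moment_abs_odd[OF \<sigma>(1), of 0 1] exp[of "\<lambda>x. \<bar>x\<bar>^3"] by simp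
  \<comment> \<open>Only the order \<delta>^(3/2) matters, so sqrt (2 / pi) is bounded by 1.\<close>
  also have "\<dots> \<le> 2 * \<sigma>^3 * 1"
    using \<sigma> pi_gt3 by (intro mult_left_mono) (auto simp: field_simps)
  also have "\<dots> = 2 * \<delta> * sqrt \<delta>"
    using \<sigma> by (simp add: power3_eq_cube power2_eq_square \<sigma>_def[symmetric])
  finally show "expectation (\<lambda>\<omega>. \<bar>step i \<omega>\<bar>^3) \<le> 2 * \<delta> * sqrt \<delta>" .
qed

text \<open>As 2 pi \<ge> 4, the Gaussian density never exceeds 1 / (2 \<sigma>), and the interval
  has length 2 e.\<close>

lemma small_position_probability:
  assumes i: "0 < i" "i \<le> n" and e: "0 < e"
  shows "expectation (\<lambda>\<omega>. indicator {-e..e} (X i \<omega>)) \<le> e / sqrt (real i * \<delta>)"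
proof -
  define \<sigma> where "\<sigma> = sqrt (real i * \<delta>)"
  have \<sigma>: "0 < \<sigma>" using \<delta>_pos i by (simp add: \<sigma>_def)
  have D: "distributed M lborel (X i) (normal_density 0 \<sigma>)"
    using position_distributed[OF i] by (simp add: \<sigma>_def)
  have d: "normal_density 0 \<sigma> x \<le> 1 / (2 * \<sigma>)" for x
  proof -
    have "2 * \<sigma> \<le> sqrt (2 * pi * \<sigma>\<^sup>2)"
      using \<sigma> pi_gt3 by (intro real_le_rsqrt) (auto simp: power_mult_distrib)
    then have "1 / sqrt (2 * pi * \<sigma>\<^sup>2) * exp (- (x - 0)\<^sup>2 / (2 * \<sigma>\<^sup>2)) \<le> 1 / (2 * \<sigma>) * 1"
      using \<sigma> by (intro mult_mono frac_le) auto
    then show ?thesis by (simp add: normal_density_def)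
  qed
  have "expectation (\<lambda>\<omega>. indicator {-e..e} (X i \<omega>)) = (\<integral>x. normal_density 0 \<sigma> x * indicator {-e..e} x \<partial>lborel)"
    using distributed_integral[OF D, of "indicator {-e..e}"] by simp
  also have "\<dots> \<le> (\<integral>x. 1 / (2 * \<sigma>) * indicator {-e..e} x \<partial>lborel)"
  proof (rule integral_mono)
    show "integrable lborel (\<lambda>x. 1 / (2 * \<sigma>) * indicator {-e..e} x)"
      by (intro integrable_mult_right integrable_real_indicator) (auto simp: emeasure_lborel_Icc_eq)
    show "integrable lborel (\<lambda>x. normal_density 0 \<sigma> x * indicator {-e..e} x)"
      using integrable_real_mult_indicator[of "{-e..e}" lborel "normal_density 0 \<sigma>"] \<sigma> by simp
  qed (use d in \<open>auto simp: indicator_def\<close>)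
  also have "\<dots> = e / \<sigma>" using e by simp
  finally show ?thesis by (simp add: \<sigma>_def)
qed

text \<open>The start contributes 1; afterwards 1 / sqrt i is dominated by the telescoping
  difference 2 (sqrt i - sqrt (i - 1)). Multiplied by \<delta>, with k \<delta> = t, the bound reads
  \<delta> + 2 e sqrt t: the expected time near 0 is of order e.\<close>

lemma sum_small_position_probability:
  assumes e: "0 < e" and k: "k \<le> n"
  shows "(\<Sum>i<Suc k. expectation (\<lambda>\<omega>. indicator {-e..e} (X i \<omega>))) \<le> 1 + 2 * e * (sqrt (real k) / sqrt \<delta>)"
  using k
proof (induction k)
  case 0
  then show ?case using e by (simp add: X_0 prob_space)
next
  case (Suc k)
  have pos: "0 < sqrt (real (Suc k))" by simp
  \<comment> \<open>The geometric mean of k and k + 1 is at most their arithmetic mean k +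
    1/2.\<close>
  have "1 \<le> 2 * (sqrt (real (Suc k)) - sqrt (real k)) * sqrt (real (Suc k))"
  proof -
    have "2 * (sqrt (real k) * sqrt (real (Suc k))) \<le> (sqrt (real k))\<^sup>2 + (sqrt (real (Suc k)))\<^sup>2"
      using sum_squares_bound[of "sqrt (real k)" "sqrt (real (Suc k))"] by simp
    moreover have "sqrt (real (Suc k)) * sqrt (real (Suc k)) = real (Suc k)" by simp
    ultimately show ?thesis by (simp add: algebra_simps)
  qed
  then have "1 / sqrt (real (Suc k)) \<le> 2 * (sqrt (real (Suc k)) - sqrt (real k))"
    using pos by (simp only: pos_divide_le_eq)
  then have "e / sqrt \<delta> * (1 / sqrt (real (Suc k))) \<le> e / sqrt \<delta> * (2 * (sqrt (real (Suc k)) - sqrt (real k)))"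
    using e \<delta>_pos by (intro mult_left_mono) auto
  moreover have "expectation (\<lambda>\<omega>. indicator {-e..e} (X (Suc k) \<omega>)) \<le> e / sqrt \<delta> * (1 / sqrt (real (Suc k)))"
    using small_position_probability[of "Suc k" e] Suc.prems e by (simp add: real_sqrt_mult mult.commute)
  moreover have "e / sqrt \<delta> * (2 * (sqrt (real (Suc k)) - sqrt (real k)))
    = 2 * e * (sqrt (real (Suc k)) / sqrt \<delta>) - 2 * e * (sqrt (real k) / sqrt \<delta>)"
    by (simp add: diff_divide_distrib algebra_simps)
  moreover note Suc.IH
  ultimately show ?case using Suc.prems by simp
qed

end

section \<open>The discrete Tanaka formula in mean\<close>

context gaussian_walk
begin

text \<open>The four terms bound separate errors: mollifying |x| at both ends of the walk, the cubic
  Taylor remainder (\<open>C\<close>), the mollified derivative in place of the sign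
  (\<open>A\<close>), and squared steps in place of \<delta> (\<open>B\<close>). For
  \<open>A\<close> and \<open>B\<close> a termwise bound would be too crude; orthogonality supplies
  the square roots.\<close>

lemma discrete_local_time_estimate:
  assumes e: "0 < e"
  defines "V \<equiv> (\<lambda>\<omega>. discrete_local_time (\<lambda>i. X i \<omega>) n)"
    and "Q \<equiv> (\<lambda>\<omega>. (\<Sum>i<n. smooth_abs'' e (X i \<omega>) * \<delta>) / 2)"
  shows "integrable M (\<lambda>\<omega>. V \<omega> - Q \<omega>)"
    and "expectation (\<lambda>\<omega>. \<bar>V \<omega> - Q \<omega>\<bar>) \<le> 2 * e + real n * (2 * \<delta> * sqrt \<delta>) / e\<^sup>2
      + sqrt (4 * (1 + 2 * e * (sqrt (real n) / sqrt \<delta>)) * \<delta>)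
      + sqrt (real n * (2 / e)\<^sup>2 * (2 * \<delta>\<^sup>2)) / 2"
proof -
  have Xm [measurable]: "X i \<in> borel_measurable M" if "i \<le> n" for i
    using that by (rule X_measurable)
  define h where "h x = smooth_abs' e x - left_sgn x" for x
  have hm [measurable]: "h \<in> borel_measurable borel" unfolding h_def by measurable
  have hb: "\<bar>h x\<bar> \<le> 2 * indicator {-e..e} x" for x
    unfolding h_def by (rule smooth_abs'_near_sgn[OF e])
  have h2: "\<bar>h x\<bar> \<le> 2" for x using hb[of x] by (cases "x \<in> {-e..e}") auto
  define A where "A \<omega> = (\<Sum>i<n. h (X i \<omega>) * step i \<omega>)" for \<omega>
  define B where "B \<omega> = (\<Sum>i<n. smooth_abs'' e (X i \<omega>) * ((step i \<omega>)\<^sup>2 - \<delta>))" for \<omega>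
  define C where "C \<omega> = (\<Sum>i<n. \<bar>step i \<omega>\<bar>^3)" for \<omega>
  have A: "integrable M A" "expectation (\<lambda>\<omega>. \<bar>A \<omega>\<bar>) \<le> sqrt (4 * (1 + 2 * e * (sqrt (real n) / sqrt \<delta>)) * \<delta>)"
  proof -
    have *: "integrable M A \<and> integrable M (\<lambda>\<omega>. (A \<omega>)\<^sup>2) \<and>
      expectation (\<lambda>\<omega>. (A \<omega>)\<^sup>2) = (\<Sum>i<n. expectation (\<lambda>\<omega>. (h (X i \<omega>))\<^sup>2) * \<delta>)"
      unfolding A_def using step_moments
      by (intro martingale_sum_second_moment[where \<phi> = "\<lambda>x. x", OF hm h2]) auto
    have ind: "integrable M (\<lambda>\<omega>. indicator {-e..e} (X i \<omega>) :: real)" if "i \<le> n" for i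
      using that by (intro integrable_const_bound[where B = 1]) auto
    have "expectation (\<lambda>\<omega>. (h (X i \<omega>))\<^sup>2) \<le> 4 * expectation (\<lambda>\<omega>. indicator {-e..e} (X i \<omega>))"
      if "i < n" for i
    proof -
      have "expectation (\<lambda>\<omega>. (h (X i \<omega>))\<^sup>2) \<le> expectation (\<lambda>\<omega>. 4 * indicator {-e..e} (X i \<omega>))"
      proof (rule integral_mono)
        have sq: "(h x)\<^sup>2 \<le> 4 * indicator {-e..e} x" for x
          using power_mono[OF hb[of x], of 2] by (auto simp: power_mult_distrib indicator_def split: if_splits)
        then show "(h (X i \<omega>))\<^sup>2 \<le> 4 * indicator {-e..e} (X i \<omega>)" for \<omega> .
        show "integrable M (\<lambda>\<omega>. 4 * indicator {-e..e} (X i \<omega>) :: real)"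
          using ind that by simp
        then show "integrable M (\<lambda>\<omega>. (h (X i \<omega>))\<^sup>2)"
          by (rule Bochner_Integration.integrable_bound) (use sq that in \<open>auto simp: indicator_def\<close>)
      qed
      then show ?thesis by simp
    qed
    then have "(\<Sum>i<n. expectation (\<lambda>\<omega>. (h (X i \<omega>))\<^sup>2) * \<delta>)
      \<le> (\<Sum>i<n. 4 * expectation (\<lambda>\<omega>. indicator {-e..e} (X i \<omega>)) * \<delta>)"
      using \<delta>_pos by (intro sum_mono mult_right_mono) auto
    \<comment> \<open>The added term i = n is nonnegative and brings the sum to the range of
      \<open>sum_small_position_probability\<close>.\<close>
    also have "\<dots> \<le> (\<Sum>i<Suc n. 4 * expectation (\<lambda>\<omega>. indicator {-e..e} (X i \<omega>)) * \<delta>)"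
      using \<delta>_pos by (simp add: Bochner_Integration.integral_nonneg)
    also have "\<dots> = 4 * (\<Sum>i<Suc n. expectation (\<lambda>\<omega>. indicator {-e..e} (X i \<omega>))) * \<delta>"
      by (simp only: sum_distrib_left sum_distrib_right)
    also have "\<dots> \<le> 4 * (1 + 2 * e * (sqrt (real n) / sqrt \<delta>)) * \<delta>"
      using \<delta>_pos sum_small_position_probability[OF e, of n]
      by (intro mult_right_mono mult_left_mono) auto
    finally show "expectation (\<lambda>\<omega>. \<bar>A \<omega>\<bar>) \<le> sqrt (4 * (1 + 2 * e * (sqrt (real n) / sqrt \<delta>)) * \<delta>)"
      using * by (intro expectation_abs_le_sqrt) auto
    show "integrable M A" using * by simp
  qed
  have B: "integrable M B" "expectation (\<lambda>\<omega>. \<bar>B \<omega>\<bar>) \<le> sqrt (real n * (2 / e)\<^sup>2 * (2 * \<delta>\<^sup>2))"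
  proof -
    have b: "\<bar>smooth_abs'' e x\<bar> \<le> 2 / e" for x using smooth_abs''_bounds[OF e, of x] by simp
    have *: "integrable M B \<and> integrable M (\<lambda>\<omega>. (B \<omega>)\<^sup>2) \<and>
      expectation (\<lambda>\<omega>. (B \<omega>)\<^sup>2) = (\<Sum>i<n. expectation (\<lambda>\<omega>. (smooth_abs'' e (X i \<omega>))\<^sup>2) * (2 * \<delta>\<^sup>2))"
      unfolding B_def using step_moments
      by (intro martingale_sum_second_moment[where \<phi> = "\<lambda>x. x\<^sup>2 - \<delta>", OF _ b]) (auto simp: prob_space)
    have "expectation (\<lambda>\<omega>. (smooth_abs'' e (X i \<omega>))\<^sup>2) \<le> (2 / e)\<^sup>2" if "i < n" for i
    proof -
      have sq: "(smooth_abs'' e x)\<^sup>2 \<le> (2 / e)\<^sup>2" for x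
        using power_mono[OF b[of x], of 2] by simp
      have "integrable M (\<lambda>\<omega>. (smooth_abs'' e (X i \<omega>))\<^sup>2)"
        using that sq by (intro integrable_const_bound[where B = "(2 / e)\<^sup>2"]) auto
      then have "expectation (\<lambda>\<omega>. (smooth_abs'' e (X i \<omega>))\<^sup>2) \<le> expectation (\<lambda>\<omega>. (2 / e)\<^sup>2)"
        using sq by (intro integral_mono) auto
      then show ?thesis by (simp add: prob_space)
    qed
    then have "(\<Sum>i<n. expectation (\<lambda>\<omega>. (smooth_abs'' e (X i \<omega>))\<^sup>2) * (2 * \<delta>\<^sup>2))
      \<le> (\<Sum>i<n. (2 / e)\<^sup>2 * (2 * \<delta>\<^sup>2))"
      by (intro sum_mono mult_right_mono) auto
    then show "expectation (\<lambda>\<omega>. \<bar>B \<omega>\<bar>) \<le> sqrt (real n * (2 / e)\<^sup>2 * (2 * \<delta>\<^sup>2))"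
      using * by (intro expectation_abs_le_sqrt) auto
    show "integrable M B" using * by simp
  qed
  have C: "integrable M C" "expectation C \<le> real n * (2 * \<delta> * sqrt \<delta>)"
  proof -
    show "integrable M C" unfolding C_def using step_moments(7) by (intro Bochner_Integration.integrable_sum) auto
    have "expectation C = (\<Sum>i<n. expectation (\<lambda>\<omega>. \<bar>step i \<omega>\<bar>^3))"
      unfolding C_def using step_moments(7) by (intro Bochner_Integration.integral_sum) auto
    also have "\<dots> \<le> (\<Sum>i<n. 2 * \<delta> * sqrt \<delta>)"
      using step_moments(8) by (intro sum_mono) auto
    finally show "expectation C \<le> real n * (2 * \<delta> * sqrt \<delta>)" by simp
  qed
  have bound: "\<bar>V \<omega> - Q \<omega>\<bar> \<le> 2 * e + C \<omega> / e\<^sup>2 + \<bar>A \<omega>\<bar> + \<bar>B \<omega>\<bar> / 2" for \<omega>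
  proof -
    define R where "R i = smooth_abs e (X (Suc i) \<omega>) - smooth_abs e (X i \<omega>) - smooth_abs' e (X i \<omega>) * step i \<omega>
      - smooth_abs'' e (X i \<omega>) * (step i \<omega>)\<^sup>2 / 2" for i
    have "\<bar>R i\<bar> \<le> \<bar>step i \<omega>\<bar>^3 / e\<^sup>2" for i
      using smooth_abs_taylor[OF e, of "X i \<omega>" "step i \<omega>"] by (simp add: R_def step_def)
    then have "\<bar>\<Sum>i<n. R i\<bar> \<le> (\<Sum>i<n. \<bar>step i \<omega>\<bar>^3 / e\<^sup>2)"
      by (intro order_trans[OF sum_abs] sum_mono)
    then have R: "\<bar>\<Sum>i<n. R i\<bar> \<le> C \<omega> / e\<^sup>2"
      by (simp add: C_def sum_divide_distrib)
    have tel: "(\<Sum>i<n. smooth_abs e (X (Suc i) \<omega>) - smooth_abs e (X i \<omega>)) = smooth_abs e (X n \<omega>) - smooth_abs e 0"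
      using sum_lessThan_telescope[of "\<lambda>i. smooth_abs e (X i \<omega>)" n] by (simp add: X_0)
    \<comment> \<open>The derivative is split into the sign plus \<open>h\<close>, and the squared
      step into \<delta> plus its centred part. After summation the sign part is
      \<open>sgn_sum\<close> and the \<delta> part is \<open>Q\<close>.\<close>
    have "smooth_abs e (X (Suc i) \<omega>) - smooth_abs e (X i \<omega>)
      = R i + h (X i \<omega>) * step i \<omega> + smooth_abs'' e (X i \<omega>) * ((step i \<omega>)\<^sup>2 - \<delta>) / 2
        + smooth_abs'' e (X i \<omega>) * \<delta> / 2 + left_sgn (X i \<omega>) * (X (Suc i) \<omega> - X i \<omega>)" for i
      by (simp add: R_def h_def step_def field_simps)
    then have "smooth_abs e (X n \<omega>) - smooth_abs e 0
      = (\<Sum>i<n. R i) + A \<omega> + B \<omega> / 2 + Q \<omega> + sgn_sum (\<lambda>i. X i \<omega>) n"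
      unfolding tel[symmetric]
      by (simp add: sum.distrib A_def B_def Q_def sgn_sum_def sum_divide_distrib)
    then have "V \<omega> - Q \<omega> = (\<bar>X n \<omega>\<bar> - smooth_abs e (X n \<omega>)) + smooth_abs e 0 + (\<Sum>i<n. R i) + A \<omega> + B \<omega> / 2"
      by (simp add: V_def discrete_local_time_def)
    moreover have "\<bar>\<bar>X n \<omega>\<bar> - smooth_abs e (X n \<omega>)\<bar> \<le> e"
      using smooth_abs_near_abs[OF e, of "X n \<omega>"] by linarith
    moreover have "\<bar>smooth_abs e 0\<bar> \<le> e" using smooth_abs_near_abs[OF e, of 0] by simp
    ultimately show ?thesis using R by linarith
  qed
  have int: "integrable M (\<lambda>\<omega>. 2 * e + C \<omega> / e\<^sup>2 + \<bar>A \<omega>\<bar> + \<bar>B \<omega>\<bar> / 2)"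
    using A B C by simp
  have VQ: "(\<lambda>\<omega>. V \<omega> - Q \<omega>) \<in> borel_measurable M"
    unfolding V_def Q_def discrete_local_time_def sgn_sum_def
    by (intro borel_measurable_diff borel_measurable_divide borel_measurable_sum borel_measurable_times
        borel_measurable_abs measurable_compose[OF _ borel_measurable_smooth_abs(3)]
        measurable_compose[OF _ borel_measurable_smooth_abs(4)] Xm) auto
  show VQi: "integrable M (\<lambda>\<omega>. V \<omega> - Q \<omega>)"
    by (rule Bochner_Integration.integrable_bound[OF int VQ]) (use bound in \<open>auto intro!: AE_I2 intro: order_trans abs_ge_self\<close>)
  have "expectation (\<lambda>\<omega>. \<bar>V \<omega> - Q \<omega>\<bar>) \<le> expectation (\<lambda>\<omega>. 2 * e + C \<omega> / e\<^sup>2 + \<bar>A \<omega>\<bar> + \<bar>B \<omega>\<bar> / 2)"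
    using VQi int bound by (intro integral_mono) auto
  also have "\<dots> = 2 * e + expectation C / e\<^sup>2 + expectation (\<lambda>\<omega>. \<bar>A \<omega>\<bar>) + expectation (\<lambda>\<omega>. \<bar>B \<omega>\<bar>) / 2"
    using A B C by (simp add: prob_space)
  also have "\<dots> \<le> 2 * e + real n * (2 * \<delta> * sqrt \<delta>) / e\<^sup>2
      + sqrt (4 * (1 + 2 * e * (sqrt (real n) / sqrt \<delta>)) * \<delta>)
      + sqrt (real n * (2 / e)\<^sup>2 * (2 * \<delta>\<^sup>2)) / 2"
    using A B C by (intro add_mono divide_right_mono) auto
  finally show "expectation (\<lambda>\<omega>. \<bar>V \<omega> - Q \<omega>\<bar>) \<le> 2 * e + real n * (2 * \<delta> * sqrt \<delta>) / e\<^sup>2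
      + sqrt (4 * (1 + 2 * e * (sqrt (real n) / sqrt \<delta>)) * \<delta>)
      + sqrt (real n * (2 / e)\<^sup>2 * (2 * \<delta>\<^sup>2)) / 2" .
qed

end

subsection \<open>Passage to the limit\<close>

text \<open>Preimages under almost everywhere equal functions differ by a subset of a null set,
  which the completion contains. Hence it suffices to find Borel versions on \<open>M\<close> with
  equal laws.\<close>

lemma eq_in_distribution_AE:
  assumes [measurable]: "Y \<in> borel_measurable M" "Y' \<in> borel_measurable M"
    and X: "AE \<omega> in M. X \<omega> = Y \<omega>" "AE \<omega> in M. X' \<omega> = Y' \<omega>"
    and distr: "distr M borel Y = distr M borel Y'"
  shows "eq_in_distribution M X X'"
proof -
  have *: "Z \<in> borel_measurable (completion M) \<and> distr (completion M) borel Z = distr M borel Y"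
    if Y [measurable]: "Y \<in> borel_measurable M" and eq: "AE \<omega> in M. Z \<omega> = Y \<omega>" for Y Z :: "'a \<Rightarrow> real"
  proof
    have Yc: "Y \<in> borel_measurable (completion M)" using Y by (rule measurable_completion)
    have eq': "AE \<omega> in completion M. Z \<omega> = Y \<omega>" using eq by (rule AE_completion)
    show Zc: "Z \<in> borel_measurable (completion M)"
    proof (rule measurableI)
      fix A :: "real set" assume A: "A \<in> sets borel"
      show "Z -` A \<inter> space (completion M) \<in> sets (completion M)"
      proof (rule completion.in_sets_AE)
        show "Y -` A \<inter> space (completion M) \<in> sets (completion M)"
          using Yc A by (rule measurable_sets)
        show "AE \<omega> in completion M. (\<omega> \<in> Y -` A \<inter> space (completion M)) = (\<omega> \<in> Z -` A \<inter> space (completion M))"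
          using eq' by eventually_elim auto
      qed auto
    qed simp
    have "distr (completion M) borel Z = distr (completion M) borel Y"
      using Yc Zc eq' by (intro distr_cong_AE) auto
    then show "distr (completion M) borel Z = distr M borel Y"
      by (simp add: distr_completion[OF Y])
  qed
  show ?thesis
    unfolding eq_in_distribution_def using *[OF assms(1) X(1)] *[OF assms(2) X(2)] distr by simp
qed

section \<open>Approximation of characteristic functions\<close>

lemma iexp_lipschitz:
  fixes x y u :: real
  shows "cmod (iexp (u * x) - iexp (u * y)) \<le> \<bar>u\<bar> * \<bar>x - y\<bar>"
proof -
  have "cmod (iexp (u * x) - iexp (u * y)) = cmod (iexp (u * y) * (iexp (u * (x - y)) - 1))"
    by (simp add: right_diff_distrib exp_diff)
  also have "\<dots> = cmod (iexp (u * (x - y)) - 1)"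
    by (simp add: norm_mult)
  also have "\<dots> \<le> \<bar>u * (x - y)\<bar>"
    using iexp_approx1[of "u * (x - y)" 0] by simp
  finally show ?thesis by (simp add: abs_mult)
qed

context prob_space
begin

lemma char_distr_eq:
  "Y \<in> borel_measurable M \<Longrightarrow> char (distr M borel Y) u = expectation (\<lambda>\<omega>. iexp (u * Y \<omega>))"
  by (simp add: char_def integral_distr)

lemma integrable_iexp_mult [simp]:
  "Y \<in> borel_measurable M \<Longrightarrow> integrable M (\<lambda>\<omega>. iexp (u * Y \<omega>))"
  by (rule integrable_iexp) auto

text \<open>Only the difference is assumed to converge, not the two sequences, which is the form in
  which discrete local time and reflected maximum are close. Differences of exponentials are at most
  2, so dominated convergence applies.\<close>

lemma char_distr_diff_tendsto_0:
  assumes [measurable]: "\<And>k. Y k \<in> borel_measurable M" "\<And>k. Z k \<in> borel_measurable M"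
    and lim: "AE \<omega> in M. (\<lambda>k. Y k \<omega> - Z k \<omega> :: real) \<longlonglongrightarrow> 0"
  shows "(\<lambda>k. char (distr M borel (Y k)) u - char (distr M borel (Z k)) u) \<longlonglongrightarrow> 0"
proof -
  have "(\<lambda>k. expectation (\<lambda>\<omega>. iexp (u * Y k \<omega>) - iexp (u * Z k \<omega>))) \<longlonglongrightarrow> expectation (\<lambda>\<omega>. 0)"
  proof (rule integral_dominated_convergence[where w = "\<lambda>_. 2"])
    show "AE \<omega> in M. (\<lambda>k. iexp (u * Y k \<omega>) - iexp (u * Z k \<omega>)) \<longlonglongrightarrow> 0"
      using lim
    proof eventually_elim
      case (elim \<omega>)
      show ?case
      proof (rule Lim_null_comparison)
        show "\<forall>\<^sub>F k in sequentially. cmod (iexp (u * Y k \<omega>) - iexp (u * Z k \<omega>)) \<le> \<bar>u\<bar> * \<bar>Y k \<omega> - Z k \<omega>\<bar>"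
          by (intro always_eventually allI iexp_lipschitz)
        show "(\<lambda>k. \<bar>u\<bar> * \<bar>Y k \<omega> - Z k \<omega>\<bar>) \<longlonglongrightarrow> 0"
          using elim by (intro tendsto_mult_right_zero tendsto_rabs_zero)
      qed
    qed
    show "AE \<omega> in M. norm (iexp (u * Y k \<omega>) - iexp (u * Z k \<omega>)) \<le> 2" for k
    proof (rule AE_I2)
      show "norm (iexp (u * Y k \<omega>) - iexp (u * Z k \<omega>)) \<le> 2" for \<omega>
        using norm_triangle_ineq4[of "iexp (u * Y k \<omega>)" "iexp (u * Z k \<omega>)"]
        unfolding norm_exp_i_times by simp
    qed
  qed auto
  then show ?thesis
    by (simp only: char_distr_eq assms(1,2) Bochner_Integration.integral_diff integrable_iexp_mult
        Bochner_Integration.integral_zero)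
qed

lemma char_distr_tendsto:
  assumes "\<And>k. Y k \<in> borel_measurable M" "Z \<in> borel_measurable M"
    and lim: "AE \<omega> in M. (\<lambda>k. Y k \<omega> :: real) \<longlonglongrightarrow> Z \<omega>"
  shows "(\<lambda>k. char (distr M borel (Y k)) u) \<longlonglongrightarrow> char (distr M borel Z) u"
proof -
  have "AE \<omega> in M. (\<lambda>k. Y k \<omega> - Z \<omega>) \<longlonglongrightarrow> 0"
    using lim by eventually_elim (simp add: LIM_zero_iff)
  from char_distr_diff_tendsto_0[OF assms(1,2) this] show ?thesis
    by (simp add: LIM_zero_iff)
qed

text \<open>The Lipschitz bound integrated: closeness in mean passes to characteristic functions at
  each frequency.\<close>

lemma char_distr_diff_le:
  assumes [measurable]: "Y \<in> borel_measurable M" "Z \<in> borel_measurable M"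
    and int: "integrable M (\<lambda>\<omega>. Y \<omega> - Z \<omega> :: real)"
  shows "cmod (char (distr M borel Y) u - char (distr M borel Z) u) \<le> \<bar>u\<bar> * expectation (\<lambda>\<omega>. \<bar>Y \<omega> - Z \<omega>\<bar>)"
proof -
  have "cmod (char (distr M borel Y) u - char (distr M borel Z) u)
    = cmod (expectation (\<lambda>\<omega>. iexp (u * Y \<omega>) - iexp (u * Z \<omega>)))"
    by (simp only: char_distr_eq assms(1,2) Bochner_Integration.integral_diff integrable_iexp_mult)
  also have "\<dots> \<le> expectation (\<lambda>\<omega>. cmod (iexp (u * Y \<omega>) - iexp (u * Z \<omega>)))"
    by (rule integral_norm_bound)
  also have "\<dots> \<le> expectation (\<lambda>\<omega>. \<bar>u\<bar> * \<bar>Y \<omega> - Z \<omega>\<bar>)"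
    by (intro integral_mono integrable_norm integrable_mult_right integrable_abs int iexp_lipschitz
        Bochner_Integration.integrable_diff[OF integrable_iexp_mult integrable_iexp_mult] assms)
  finally show ?thesis by simp
qed

end

lemma distr_uminus_normal_density:
  "distr (density lborel (normal_density 0 \<sigma>)) borel uminus = density lborel (normal_density 0 \<sigma>)"
proof (rule measure_eqI)
  fix A assume "A \<in> sets (distr (density lborel (normal_density 0 \<sigma>)) borel (uminus :: real \<Rightarrow> real))"
  then have [measurable]: "A \<in> sets borel" by simp
  have "emeasure (distr (density lborel (normal_density 0 \<sigma>)) borel uminus) A
    = (\<integral>\<^sup>+ x. ennreal (normal_density 0 \<sigma> x) * indicator A (- x) \<partial>lborel)"
    using measurable_sets[of uminus borel borel A]
    by (subst emeasure_distr) (auto simp: emeasure_density intro!: nn_integral_cong split: split_indicator)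
  also have "\<dots> = (\<integral>\<^sup>+ x. ennreal (normal_density 0 \<sigma> (- x)) * indicator A x \<partial>lborel)"
    using nn_integral_real_affine[of "\<lambda>x. ennreal (normal_density 0 \<sigma> x) * indicator A (- x)" "-1" 0] by simp
  also have "\<dots> = emeasure (density lborel (normal_density 0 \<sigma>)) A"
    by (simp add: emeasure_density normal_density_def)
  finally show "emeasure (distr (density lborel (normal_density 0 \<sigma>)) borel uminus) A
    = emeasure (density lborel (normal_density 0 \<sigma>)) A" .
qed simp

section \<open>The Wiener process on a grid and the two limits\<close>

context wiener_process
begin

text \<open>\<open>W 0\<close> vanishes only almost surely, while the walk must start at 0
  everywhere; subtracting \<open>W 0\<close> repairs this and leaves the increments
  unchanged.\<close>

lemma gaussian_walk_skeleton:
  assumes \<delta>: "0 < \<delta>"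
  shows "gaussian_walk M (\<lambda>i \<omega>. W (real i * \<delta>) \<omega> - W 0 \<omega>) n \<delta>"
proof
  show "indep_vars (\<lambda>_. borel)
     (\<lambda>i \<omega>. (W (real (Suc i) * \<delta>) \<omega> - W 0 \<omega>) - (W (real i * \<delta>) \<omega> - W 0 \<omega>)) {..<n}"
    using indep_increments[of "\<lambda>i. real i * \<delta>" n] \<delta> by simp
  show "distributed M lborel (\<lambda>\<omega>. (W (real (Suc i) * \<delta>) \<omega> - W 0 \<omega>) - (W (real i * \<delta>) \<omega> - W 0 \<omega>))
      (normal_density 0 (sqrt \<delta>))" for i
    using normal_increments[of "real i * \<delta>" "real (Suc i) * \<delta>"] \<delta> by (simp add: algebra_simps)
  show "distributed M lborel (\<lambda>\<omega>. W (real i * \<delta>) \<omega> - W 0 \<omega>) (normal_density 0 (sqrt (real i * \<delta>)))"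
    if "0 < i" for i
    using normal_increments[of 0 "real i * \<delta>"] \<delta> that by simp
qed (use \<delta> in auto)

lemma eq_in_distribution_local_time_running_max:
  assumes L: "is_local_time M W L" and t: "0 < t"
  shows "eq_in_distribution M (L t 0) (running_max W t)"
proof -
  define \<delta> where "\<delta> N = t / Suc N" for N
  have \<delta>: "0 < \<delta> N" for N using t by (simp add: \<delta>_def)
  define X where "X N i \<omega> = W (real i * \<delta> N) \<omega> - W 0 \<omega>" for N i \<omega>
  define V where "V N \<omega> = discrete_local_time (\<lambda>i. X N i \<omega>) (Suc N)" for N \<omega>
  define Q where "Q e N \<omega> = (\<Sum>i<Suc N. smooth_abs'' e (X N i \<omega>) * \<delta> N) / 2" for e N \<omega>
  define R where "R N \<omega> = reflected_max (\<lambda>i. X N i \<omega>) (Suc N)" for N \<omega>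
  define S where "S N \<omega> = Max ((\<lambda>j. X N j \<omega>) ` {..Suc N})" for N \<omega>
  \<comment> \<open>\<open>lim\<close> is a total function, so these limits are
    \<open>M\<close>-measurable on the whole space. They are Borel versions of quantities that are
    not assumed measurable themselves.\<close>
  define Ql where "Ql e \<omega> = lim (\<lambda>N. Q e N \<omega>)" for e \<omega>
  define Ll where "Ll \<omega> = lim (\<lambda>m. Ql (1 / Suc m) \<omega>)" for \<omega>
  define Sl where "Sl \<omega> = lim (\<lambda>N. S N \<omega>)" for \<omega>

  have walk: "gaussian_walk M (X N) (Suc N) (\<delta> N)" for N
    unfolding X_def by (rule gaussian_walk_skeleton[OF \<delta>])

  have X [measurable]: "X N i \<in> borel_measurable M" for N i
    unfolding X_def using \<delta>[of N] by (intro borel_measurable_diff random_variable_W) auto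
  have Q [measurable]: "Q e N \<in> borel_measurable M" for e N
    unfolding Q_def by measurable
  have S [measurable]: "S N \<in> borel_measurable M" for N
    unfolding S_def by measurable
  have ss [measurable]: "(\<lambda>\<omega>. sgn_sum (\<lambda>i. X N i \<omega>) j) \<in> borel_measurable M" for N j
    unfolding sgn_sum_def by measurable
  have V [measurable]: "V N \<in> borel_measurable M" for N
    unfolding V_def discrete_local_time_def by measurable
  have R [measurable]: "R N \<in> borel_measurable M" for N
    unfolding R_def reflected_max_def by measurable
  have Ql [measurable]: "Ql e \<in> borel_measurable M" for e
    unfolding Ql_def by measurable
  have Ll [measurable]: "Ll \<in> borel_measurable M"
    unfolding Ll_def by measurable
  have Sl [measurable]: "Sl \<in> borel_measurable M"
    unfolding Sl_def by measurable

  \<comment> \<open>One null set serves all e: outside it everything follows deterministically from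
    the continuity of the path and its occupation density.\<close>
  have good: "AE \<omega> in M.
    (\<forall>e. (\<lambda>N. Q e N \<omega>) \<longlonglongrightarrow> Ql e \<omega>) \<and> (\<lambda>m. Ql (1 / Suc m) \<omega>) \<longlonglongrightarrow> Ll \<omega> \<and> L t 0 \<omega> = Ll \<omega> \<and>
    (\<lambda>N. S N \<omega>) \<longlonglongrightarrow> Sl \<omega> \<and> running_max W t \<omega> = Sl \<omega> \<and> (\<lambda>N. V N \<omega> - R N \<omega>) \<longlonglongrightarrow> 0"
    using W_0 continuous_paths L[unfolded is_local_time_def, THEN conjunct1] L[unfolded is_local_time_def, THEN conjunct2]
  proof eventually_elim
    case (elim \<omega>)
    note W0 = elim(1)
    have w: "continuous_on {0..t} (\<lambda>s. W s \<omega>)"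
      using elim(2) by (rule continuous_on_subset) auto
    have Qe: "(\<lambda>N. Q e N \<omega>) \<longlonglongrightarrow> integral {0..t} (\<lambda>s. smooth_abs'' e (W s \<omega>)) / 2" for e
    proof -
      have "continuous_on {0..t} (\<lambda>s. smooth_abs'' e (W s \<omega>))"
        using continuous_on_compose2[OF continuous_smooth_abs''[of UNIV] w] by simp
      from tendsto_divide[OF riemann_sum_tendsto[OF this t] tendsto_const, of 2]
      show ?thesis by (simp add: Q_def X_def \<delta>_def W0)
    qed
    then have QQ: "Ql e \<omega> = integral {0..t} (\<lambda>s. smooth_abs'' e (W s \<omega>)) / 2" for e
      unfolding Ql_def by (rule limI)
    have l: "continuous_on UNIV (\<lambda>x. L t x \<omega>)"
    proof -
      have "continuous_on UNIV (\<lambda>x. (\<lambda>(t, x). L t x \<omega>) (t, x))"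
        by (rule continuous_on_compose2[OF elim(3)]) (use t in \<open>auto intro!: continuous_intros\<close>)
      then show ?thesis by simp
    qed
    have "(\<lambda>m. integral {0..t} (\<lambda>s. smooth_abs'' (1 / Suc m) (W s \<omega>)) / 2) \<longlonglongrightarrow> L t 0 \<omega>"
    proof (rule occupation_density_limit[OF w l])
      show "0 \<le> L t x \<omega>" for x using elim(4) t by simp
      show "(\<integral>\<^sup>+ s\<in>{0..t}. indicator A (W s \<omega>) \<partial>lborel) = (\<integral>\<^sup>+ x\<in>A. ennreal (L t x \<omega>) \<partial>lborel)"
        if "A \<in> sets borel" for A
        using elim(4) t that by (simp add: occupation_measure_def)
    qed
    then have Lm: "(\<lambda>m. Ql (1 / Suc m) \<omega>) \<longlonglongrightarrow> L t 0 \<omega>" by (simp add: QQ)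
    then have LL: "Ll \<omega> = L t 0 \<omega>" unfolding Ll_def by (rule limI)
    have Sm: "(\<lambda>N. S N \<omega>) \<longlonglongrightarrow> running_max W t \<omega>"
      using skeleton_max_tendsto[OF w t] by (simp add: S_def X_def \<delta>_def W0 running_max_def)
    then have SS: "Sl \<omega> = running_max W t \<omega>" unfolding Sl_def by (rule limI)
    have VR: "(\<lambda>N. V N \<omega> - R N \<omega>) \<longlonglongrightarrow> 0"
    proof (rule LIMSEQ_I)
      fix r :: real assume r: "0 < r"
      then obtain K where K: "\<And>N x y. N \<ge> K \<Longrightarrow> x \<in> {0..t} \<Longrightarrow> y \<in> {0..t} \<Longrightarrow> \<bar>x - y\<bar> \<le> \<delta> N
          \<Longrightarrow> \<bar>W x \<omega> - W y \<omega>\<bar> < r / 2"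
        using uniform_increments_tendsto_0[OF w t, of "r / 2"] unfolding eventually_sequentially \<delta>_def
        by (metis half_gt_zero)
      show "\<exists>K. \<forall>N\<ge>K. norm (V N \<omega> - R N \<omega> - 0) < r"
      proof (intro exI[of _ K] allI impI)
        fix N assume N: "K \<le> N"
        have mem: "real i * \<delta> N \<in> {0..t}" if "i \<le> Suc N" for i
        proof -
          have "real i * \<delta> N \<le> real (Suc N) * \<delta> N" using that \<delta>[of N] by (intro mult_right_mono) auto
          also have "\<dots> = t" by (simp add: \<delta>_def)
          finally show ?thesis using \<delta>[of N] by simp
        qed
        have "\<bar>X N (Suc i) \<omega> - X N i \<omega>\<bar> \<le> r / 2" if "i < Suc N" for i
        proof -
          have "\<bar>W (real (Suc i) * \<delta> N) \<omega> - W (real i * \<delta> N) \<omega>\<bar> < r / 2"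
            using that \<delta>[of N] by (intro K[OF N] mem) (auto simp: algebra_simps)
          then show ?thesis by (simp add: X_def)
        qed
        then have "V N \<omega> \<le> R N \<omega> + r / 2"
          unfolding V_def R_def using r
          by (intro discrete_local_time_le_reflected_max) (auto simp: X_def)
        moreover have "R N \<omega> \<le> V N \<omega>"
          unfolding V_def R_def by (rule reflected_max_le_discrete_local_time)
        ultimately show "norm (V N \<omega> - R N \<omega> - 0) < r" using r by simp
      qed
    qed
    have "\<forall>e. (\<lambda>N. Q e N \<omega>) \<longlonglongrightarrow> Ql e \<omega>" using Qe by (simp only: QQ) simp
    then show ?case using Lm LL Sm SS VR by simp
  qed

  have Q_lim: "AE \<omega> in M. (\<lambda>N. Q e N \<omega>) \<longlonglongrightarrow> Ql e \<omega>" for e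
    using good by eventually_elim blast
  have Ql_lim: "AE \<omega> in M. (\<lambda>m. Ql (1 / Suc m) \<omega>) \<longlonglongrightarrow> Ll \<omega>"
    using good by eventually_elim blast
  have S_lim: "AE \<omega> in M. (\<lambda>N. S N \<omega>) \<longlonglongrightarrow> Sl \<omega>"
    using good by eventually_elim blast
  have VR_lim: "AE \<omega> in M. (\<lambda>N. V N \<omega> - R N \<omega>) \<longlonglongrightarrow> 0"
    using good by eventually_elim blast
  have version: "AE \<omega> in M. L t 0 \<omega> = Ll \<omega>" "AE \<omega> in M. running_max W t \<omega> = Sl \<omega>"
    using good by (eventually_elim, blast)+

  have law: "distr M borel (R N) = distr M borel (S N)" for N
  proof -
    interpret gaussian_walk M "X N" "Suc N" "\<delta> N" by (rule walk)
    have "distr M borel (\<lambda>\<omega>. X N (Suc i) \<omega> - X N i \<omega>) = density lborel (normal_density 0 (sqrt (\<delta> N)))"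
      if "i < Suc N" for i
      using distributed_distr_eq_density[OF step_distributed[OF that]] by (simp cong: distr_cong)
    from distr_reflected_max[OF X_0 indep_steps _ this distr_uminus_normal_density]
    show ?thesis by (simp add: R_def[abs_def] S_def[abs_def])
  qed

  have "char (distr M borel Ll) u = char (distr M borel Sl) u" for u
  proof -
    let ?c = "\<lambda>Y. char (distr M borel Y) u"
    have "(\<lambda>N. ?c (S N)) \<longlonglongrightarrow> ?c Sl"
      by (intro char_distr_tendsto S Sl S_lim)
    moreover have "(\<lambda>N. ?c (V N) - ?c (R N)) \<longlonglongrightarrow> 0"
      by (intro char_distr_diff_tendsto_0 V R VR_lim)
    \<comment> \<open>By \<open>law\<close> the maxima \<open>R\<close> and \<open>S\<close> have
      the same characteristic function. \<open>V\<close> is shown to converge only in this sense,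
      not along paths.\<close>
    ultimately have cV: "(\<lambda>N. ?c (V N)) \<longlonglongrightarrow> ?c Sl"
      using tendsto_add[of "\<lambda>N. ?c (V N) - ?c (R N)" 0 sequentially "\<lambda>N. ?c (S N)" "?c Sl"] law by simp
    \<comment> \<open>At fixed e the cubic and squared-step errors vanish as the grid is refined;
      the mollification error 2 e and the sign error remain.\<close>
    have bound: "cmod (?c Sl - ?c (Ql e)) \<le> \<bar>u\<bar> * (2 * e + sqrt (8 * e * sqrt t))" if e: "0 < e" for e
    proof (rule tendsto_le)
      have "(\<lambda>N. ?c (Q e N)) \<longlonglongrightarrow> ?c (Ql e)"
        by (intro char_distr_tendsto Q Ql Q_lim)
      then show "(\<lambda>N. cmod (?c (V N) - ?c (Q e N))) \<longlonglongrightarrow> cmod (?c Sl - ?c (Ql e))"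
        by (intro tendsto_norm tendsto_diff cV)
      define b where "b N = \<bar>u\<bar> * (2 * e + real (Suc N) * (2 * \<delta> N * sqrt (\<delta> N)) / e\<^sup>2
        + sqrt (4 * (1 + 2 * e * (sqrt (real (Suc N)) / sqrt (\<delta> N))) * \<delta> N)
        + sqrt (real (Suc N) * (2 / e)\<^sup>2 * (2 * (\<delta> N)\<^sup>2)) / 2)" for N
      show "\<forall>\<^sub>F N in sequentially. cmod (?c (V N) - ?c (Q e N)) \<le> b N"
      proof (intro always_eventually allI)
        fix N
        interpret gaussian_walk M "X N" "Suc N" "\<delta> N" by (rule walk)
        note est = discrete_local_time_estimate[OF e, folded V_def Q_def]
        have "cmod (?c (V N) - ?c (Q e N)) \<le> \<bar>u\<bar> * expectation (\<lambda>\<omega>. \<bar>V N \<omega> - Q e N \<omega>\<bar>)"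
          by (intro char_distr_diff_le V Q est)
        also have "\<dots> \<le> b N"
          unfolding b_def by (intro mult_left_mono est) auto
        finally show "cmod (?c (V N) - ?c (Q e N)) \<le> b N" .
      qed
      show "b \<longlonglongrightarrow> \<bar>u\<bar> * (2 * e + sqrt (8 * e * sqrt t))"
      proof -
        have \<delta>_lim: "\<delta> \<longlonglongrightarrow> 0" unfolding \<delta>_def by real_asymp
        have "(\<lambda>N. \<bar>u\<bar> * (2 * e + 2 * t / e\<^sup>2 * sqrt (\<delta> N) + sqrt (4 * \<delta> N + 8 * e * sqrt t)
            + sqrt (8 * t / e\<^sup>2 * \<delta> N) / 2))
          \<longlonglongrightarrow> \<bar>u\<bar> * (2 * e + 2 * t / e\<^sup>2 * sqrt 0 + sqrt (4 * 0 + 8 * e * sqrt t)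
            + sqrt (8 * t / e\<^sup>2 * 0) / 2)"
          by (intro tendsto_intros \<delta>_lim) auto
        moreover have "b N = \<bar>u\<bar> * (2 * e + 2 * t / e\<^sup>2 * sqrt (\<delta> N) + sqrt (4 * \<delta> N + 8 * e * sqrt t)
            + sqrt (8 * t / e\<^sup>2 * \<delta> N) / 2)" for N
        proof -
          have n\<delta>: "real (Suc N) * \<delta> N = t" by (simp add: \<delta>_def)
          have 1: "real (Suc N) * (2 * \<delta> N * sqrt (\<delta> N)) / e\<^sup>2 = 2 * (real (Suc N) * \<delta> N) / e\<^sup>2 * sqrt (\<delta> N)"
            by simp
          \<comment> \<open>This scaling keeps the occupation time near 0 at order e sqrt t however
            fine the grid is, which is where sqrt (8 e sqrt t) comes from.\<close>
          have "sqrt (real (Suc N)) / sqrt (\<delta> N) * \<delta> N = sqrt (real (Suc N)) * sqrt (\<delta> N)"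
            using \<delta>[of N] by (simp add: real_div_sqrt field_simps)
          also have "\<dots> = sqrt t" using n\<delta> by (simp only: real_sqrt_mult[symmetric])
          finally have q: "sqrt (real (Suc N)) / sqrt (\<delta> N) * \<delta> N = sqrt t" .
          have "4 * (1 + 2 * e * x) * y = 4 * y + 8 * e * (x * y)" for x y by (simp add: algebra_simps)
          from this[of "sqrt (real (Suc N)) / sqrt (\<delta> N)" "\<delta> N", unfolded q]
          have 2: "4 * (1 + 2 * e * (sqrt (real (Suc N)) / sqrt (\<delta> N))) * \<delta> N = 4 * \<delta> N + 8 * e * sqrt t" .
          have "x * (2 / e)\<^sup>2 * (2 * y\<^sup>2) = 8 * (x * y) / e\<^sup>2 * y" for x y
            by (simp add: power_divide) (simp add: power2_eq_square)
          from this[of "real (Suc N)" "\<delta> N"]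
          have 3: "real (Suc N) * (2 / e)\<^sup>2 * (2 * (\<delta> N)\<^sup>2) = 8 * (real (Suc N) * \<delta> N) / e\<^sup>2 * \<delta> N" .
          show ?thesis unfolding b_def 1 2 3 n\<delta> ..
        qed
        then have "b = (\<lambda>N. \<bar>u\<bar> * (2 * e + 2 * t / e\<^sup>2 * sqrt (\<delta> N) + sqrt (4 * \<delta> N + 8 * e * sqrt t)
            + sqrt (8 * t / e\<^sup>2 * \<delta> N) / 2))" by (rule ext)
        ultimately show ?thesis by simp
      qed
    qed simp
    \<comment> \<open>Only now does e tend to 0, along the sequence 1 / (m + 1), so that
      \<open>Ll\<close> is a countable limit and measurable.\<close>
    have "cmod (?c Sl - ?c Ll) \<le> 0"
    proof (rule tendsto_le)
      have "(\<lambda>m. ?c (Ql (1 / Suc m))) \<longlonglongrightarrow> ?c Ll"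
        by (intro char_distr_tendsto Ql Ll Ql_lim)
      then show "(\<lambda>m. cmod (?c Sl - ?c (Ql (1 / Suc m)))) \<longlonglongrightarrow> cmod (?c Sl - ?c Ll)"
        by (intro tendsto_norm tendsto_diff tendsto_const)
      show "\<forall>\<^sub>F m in sequentially. cmod (?c Sl - ?c (Ql (1 / Suc m)))
          \<le> \<bar>u\<bar> * (2 * (1 / Suc m) + sqrt (8 * (1 / Suc m) * sqrt t))"
        by (intro always_eventually allI bound) simp
      have "(\<lambda>m. \<bar>u\<bar> * (2 * (1 / real (Suc m)) + sqrt (8 * (1 / real (Suc m)) * sqrt t)))
        \<longlonglongrightarrow> \<bar>u\<bar> * (2 * 0 + sqrt (8 * 0 * sqrt t))"
        by (intro tendsto_intros LIMSEQ_inverse_real_of_nat[unfolded inverse_eq_divide])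
      then show "(\<lambda>m. \<bar>u\<bar> * (2 * (1 / Suc m) + sqrt (8 * (1 / Suc m) * sqrt t))) \<longlonglongrightarrow> 0"
        by simp
    qed simp
    then show ?thesis by simp
  qed
  then have "distr M borel Ll = distr M borel Sl"
    by (intro Levy_uniqueness real_distribution_distr) auto
  then show ?thesis
    by (rule eq_in_distribution_AE[OF Ll Sl version])
qed

text \<open>Time 0 is separate because the grid spacing must be positive. Over the degenerate
  interval every mollified integral is 0, and continuity in x carries this to the density at
  0.\<close>

lemma local_time_0:
  assumes "is_local_time M W L"
  shows "AE \<omega> in M. L 0 0 \<omega> = 0"
  using assms[unfolded is_local_time_def, THEN conjunct1] assms[unfolded is_local_time_def, THEN conjunct2]
proof eventually_elim
  case (elim \<omega>)
  have "continuous_on UNIV (\<lambda>x. (\<lambda>(t, x). L t x \<omega>) (0, x))"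
    by (rule continuous_on_compose2[OF elim(1)]) (auto intro!: continuous_intros)
  then have c: "continuous_on UNIV (\<lambda>x. L 0 x \<omega>)" by simp
  have "(\<lambda>m. integral {0..0} (\<lambda>s. smooth_abs'' (1 / Suc m) (W s \<omega>)) / 2) \<longlonglongrightarrow> L 0 0 \<omega>"
    using elim(2) by (intro occupation_density_limit c) (auto simp: occupation_measure_def)
  then show ?case by (simp add: LIMSEQ_const_iff)
qed

end

theorem proposition3p4:
  fixes M :: "'a measure"
    and W :: "real \<Rightarrow> 'a \<Rightarrow> real"
    and L :: "real \<Rightarrow> real \<Rightarrow> 'a \<Rightarrow> real"
    and t :: real
  assumes "wiener_process M W"
    and "is_local_time M W L"
    and "0 \<le> t"
  shows "eq_in_distribution M (L t 0) (running_max W t)"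
proof (cases "t = 0")
  case True
  interpret wiener_process M W by (rule assms(1))
  have "AE \<omega> in M. running_max W 0 \<omega> = 0"
    using W_0 by eventually_elim (simp add: running_max_def)
  then show ?thesis
    unfolding True using local_time_0[OF assms(2)]
    by (intro eq_in_distribution_AE[where Y = "\<lambda>_. 0" and Y' = "\<lambda>_. 0"]) auto
next
  case False
  then show ?thesis
    using wiener_process.eq_in_distribution_local_time_running_max[OF assms(1,2)] assms(3) by simp
qed

end
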